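(* Let $(X,\rho,\mu)$ be a space of homogeneous type satisfying the standing assumptions listed in the context, and suppose that there are constants $b,\gamma>0$ such that $\mu B(x,r)\le b r^{\gamma}$ for all $x\in X$ and $0<r<d$. Let $1<p<\infty$, $0\le\lambda<1/\gamma$, $0<\alpha<\frac{(1-\lambda)\gamma}{p}$ and $\frac1p-\frac1q=\frac{\alpha}{(1-\lambda)\gamma}$. Let $\theta_1>0$ and set $$\theta_2=\left[1+\frac{\alpha q}{(1-\lambda)\gamma}\right]\theta_1 .$$ Then the potential operator $$(I_\alpha f)(x)=\int_X\frac{f(y)}{\rho(x,y)^{\gamma-\alpha}}\,d\mu(y),\qquad x\in X,$$ is bounded from $\mathcal{L}^{p),\theta_1,\lambda}(X,\mu)$ to $\mathcal{L}^{q),\theta_2,\lambda}(X,\mu)$; that is, there is a constant $C>0$ such that $\|I_\alpha f\|_{\mathcal{L}^{q),\theta_2,\lambda}(X,\mu)}\le C\|f\|_{\mathcal{L}^{p),\theta_1,\lambda}(X,\mu)}$ for all $f\in\mathcal{L}^{p),\theta_1,\lambda}(X,\mu)$.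
   Context: Standing assumptions on $(X,\rho,\mu)$. $X$ is a topological space with a complete measure $\mu$ such that the compactly supported continuous functions are dense in $L^1(X,\mu)$, and $\rho:X\times X\to[0,\infty)$ is a quasi-metric: (i) $\rho(x,y)=0$ iff $x=y$; (ii) there is $a_1>0$ with $\rho(x,y)\le a_1(\rho(x,z)+\rho(z,y))$ for all $x,y,z\in X$; (iii) there is $a_0>0$ with $\rho(x,y)\le a_0\rho(y,x)$ for all $x,y\in X$. Balls $B(x,r)=\{y\in X:\rho(x,y)<r\}$ are measurable with $0<\mu(B(x,r))<\infty$ for all $x\in X$, $r>0$; for every neighborhood $V$ of $x\in X$ there is $r>0$ with $B(x,r)\subset V$; $\mu\{x\}=0$ for all $x\in X$; $d:=\operatorname{diam}(X)=\sup\{\rho(x,y):x,y\in X\}<\infty$; $B(x,R)\setminus B(x,r)\ne\emptyset$ for all $x\in X$ and $0<r<R<d$; and $\mu$ is doubling: there is $c>0$ with $\mu(B(x,2r))\le c\,\mu(B(x,r))$ for all $x\in X$, $r>0$. Grand Morrey space (with powers of the radius). For $1<s<\infty$, $\theta>0$ and $0\le\lambda<1/\gamma$ (with $\gamma$ the exponent in the condition $\mu B(x,r)\le br^\gamma$), $\mathcal{L}^{s),\theta,\lambda}(X,\mu)$ is the class of measurable $f:X\to\mathbb{R}$ for which $$\|f\|_{\mathcal{L}^{s),\theta,\lambda}(X,\mu)}=\sup_{0<\varepsilon<s-1}\ \sup_{x\in X,\ 0<r<d}\left(\frac{\varepsilon^{\theta}}{r^{\gamma\lambda}}\int_{B(x,r)}|f(y)|^{s-\varepsilon}\,d\mu(y)\right)^{\frac{1}{s-\varepsilon}}<\infty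 .$$
   Formalization: Membership of I_α f in the target space is asserted only if ρ is jointly measurable for the completed product measure, as otherwise I_α f may be non-measurable; the norm inequality holds without this, read as a lower integral when I_α f is not measurable. *)

theory Defs
  imports "HOL-Analysis.Analysis"
begin

text \<open>The space \<open>X\<close> is the carrier of the topological type \<open>'a\<close>.\<close>

definition qball :: "('a \<Rightarrow> 'a \<Rightarrow> real) \<Rightarrow> 'a \<Rightarrow> real \<Rightarrow> 'a set" where
  "qball \<rho> x r = {y. \<rho> x y < r}"

definition qdiam :: "('a \<Rightarrow> 'a \<Rightarrow> real) \<Rightarrow> real" where
  "qdiam \<rho> = Sup (range (\<lambda>(x, y). \<rho> x y))"

definition compactly_supported_continuous :: "('a::topological_space \<Rightarrow> real) \<Rightarrow> bool" where
  "compactly_supported_continuous g \<longleftrightarrow>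
     continuous_on UNIV g \<and> compact (closure {x. g x \<noteq> 0})"

text \<open>No compatibility of \<open>M\<close> with the Borel sets is required; \<open>Cc_integrable\<close> and \<open>Cc_dense\<close>
  together say that the compactly supported continuous functions form a dense subset of
  \<open>L\<^sup>1\<close>.\<close>

locale homogeneous_space = complete_measure M
  for M :: "'a::topological_space measure" +
  fixes \<rho> :: "'a \<Rightarrow> 'a \<Rightarrow> real"
  assumes space_M: "space M = UNIV"
    and Cc_integrable: "compactly_supported_continuous g \<Longrightarrow> integrable M g"
    and Cc_dense: "integrable M f \<Longrightarrow> e > 0 \<Longrightarrow>
          \<exists>g. compactly_supported_continuous g \<and> (\<integral>x. \<bar>f x - g x\<bar> \<partial>M) < e"
    and rho_nonneg: "\<rho> x y \<ge> 0"
    and rho_eq_0_iff: "\<rho> x y = 0 \<longleftrightarrow> x = y"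
    and quasi_triangle: "\<exists>a\<^sub>1>0. \<forall>x y z. \<rho> x y \<le> a\<^sub>1 * (\<rho> x z + \<rho> z y)"
    and quasi_symmetric: "\<exists>a\<^sub>0>0. \<forall>x y. \<rho> x y \<le> a\<^sub>0 * \<rho> y x"
    and qball_sets: "r > 0 \<Longrightarrow> qball \<rho> x r \<in> sets M"
    and qball_pos: "r > 0 \<Longrightarrow> emeasure M (qball \<rho> x r) > 0"
    and qball_finite: "r > 0 \<Longrightarrow> emeasure M (qball \<rho> x r) < \<infinity>"
    and qball_in_nhd: "open V \<Longrightarrow> x \<in> V \<Longrightarrow> \<exists>r>0. qball \<rho> x r \<subseteq> V"
    and singleton_null: "{x} \<in> null_sets M"
    and diam_finite: "bdd_above (range (\<lambda>(x, y). \<rho> x y))"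
    and annulus_nonempty: "0 < r \<Longrightarrow> r < R \<Longrightarrow> R < qdiam \<rho> \<Longrightarrow> qball \<rho> x R - qball \<rho> x r \<noteq> {}"
    and doubling: "\<exists>c>0. \<forall>x r. r > 0 \<longrightarrow>
          emeasure M (qball \<rho> x (2 * r)) \<le> ennreal c * emeasure M (qball \<rho> x r)"

text \<open>Only used for exponents \<open>t > 0\<close>, where \<open>\<infinity>\<^sup>t = \<infinity>\<close>.\<close>

definition ennreal_powr :: "ennreal \<Rightarrow> real \<Rightarrow> ennreal" where
  "ennreal_powr a t = (if a = \<infinity> then \<infinity> else ennreal (enn2real a powr t))"

text \<open>The norm takes the value \<open>\<infinity>\<close> outside of the space. On a non-measurable function the
  integral below is a lower integral.\<close>

definition grand_morrey_norm ::
  "'a measure \<Rightarrow> ('a \<Rightarrow> 'a \<Rightarrow> real) \<Rightarrow> real \<Rightarrow> real \<Rightarrow> real \<Rightarrow> real \<Rightarrow> ('a \<Rightarrow> real) \<Rightarrow> ennreal" where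
  "grand_morrey_norm M \<rho> \<gamma> s \<theta> lam f =
     (SUP \<epsilon>\<in>{0<..<s - 1}. SUP x\<in>space M. SUP r\<in>{0<..<qdiam \<rho>}.
        ennreal_powr
          (ennreal (\<epsilon> powr \<theta> / r powr (\<gamma> * lam)) *
             (\<integral>\<^sup>+y\<in>qball \<rho> x r. ennreal (\<bar>f y\<bar> powr (s - \<epsilon>)) \<partial>M))
          (1 / (s - \<epsilon>)))"

definition grand_morrey ::
  "'a measure \<Rightarrow> ('a \<Rightarrow> 'a \<Rightarrow> real) \<Rightarrow> real \<Rightarrow> real \<Rightarrow> real \<Rightarrow> real \<Rightarrow> ('a \<Rightarrow> real) set" where
  "grand_morrey M \<rho> \<gamma> s \<theta> lam =
     {f \<in> borel_measurable M. grand_morrey_norm M \<rho> \<gamma> s \<theta> lam f < \<infinity>}"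

text \<open>On the diagonal the integrand is \<open>0\<close> by the convention for division, where the kernel is
  infinite in the mathematical definition; this does not affect the integral since points are null
  sets. The Bochner integral is \<open>0\<close> where the integrand is not integrable, so a statement about
  \<open>potential\<close> has to assert integrability almost everywhere separately.

  The axioms of \<open>homogeneous_space\<close> make each \<open>\<rho> x\<close> measurable, but not \<open>\<rho>\<close> as a function of
  two variables, and \<open>potential\<close> can then be non-measurable even for \<open>f = 1\<close>. So membership of
  \<open>potential\<close> in a function space, as opposed to a bound on its norm, presupposes measurability
  of \<open>\<rho>\<close>.\<close>

definition potential_integrand ::
  "('a \<Rightarrow> 'a \<Rightarrow> real) \<Rightarrow> real \<Rightarrow> real \<Rightarrow> ('a \<Rightarrow> real) \<Rightarrow> 'a \<Rightarrow> 'a \<Rightarrow> real" where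
  "potential_integrand \<rho> \<gamma> \<alpha> f x y = f y / \<rho> x y powr (\<gamma> - \<alpha>)"

definition potential ::
  "'a measure \<Rightarrow> ('a \<Rightarrow> 'a \<Rightarrow> real) \<Rightarrow> real \<Rightarrow> real \<Rightarrow> ('a \<Rightarrow> real) \<Rightarrow> 'a \<Rightarrow> real" where
  "potential M \<rho> \<gamma> \<alpha> f x = (\<integral>y. potential_integrand \<rho> \<gamma> \<alpha> f x y \<partial>M)"

end

theory Submission
  imports Defs
begin

text \<open>
  For \<open>1/s - 1/t = \<alpha>/((1 - \<lambda>)\<gamma>)\<close> the potential is bounded from the Morrey space of exponent \<open>s\<close> to
  the one of exponent \<open>t\<close>, uniformly for \<open>s\<close> away from \<open>1\<close>. Given a level \<open>\<tau>\<close>, choose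
  \<open>\<delta>(\<tau>)\<close> such that, by the Morrey condition, the part of the integral over \<open>\<rho>(x,y) \<ge> \<delta>\<close> is at most
  \<open>\<tau>/4\<close>, and \<open>h(\<tau>)\<close> such that the values of \<open>f\<close> below \<open>h\<close> contribute at most \<open>\<tau>/4\<close> over
  \<open>\<rho>(x,y) < \<delta>\<close>. Where the potential exceeds \<open>\<tau>\<close>, the part of \<open>f\<close> above \<open>h\<close> therefore contributes
  at least \<open>\<tau>/2\<close>, and that contribution is controlled in \<open>L\<^sup>1\<close>; integrating over \<open>\<tau>\<close> gives the strong
  estimate, without a maximal function.

  For the grand spaces, \<open>s = p - \<epsilon>\<close> and \<open>t = q - \<eta>\<close> force \<open>\<eta> \<le> q\<^sup>2\<epsilon>\<close>, and \<open>\<theta>\<^sub>2 = (q/p)\<theta>\<^sub>1\<close> makes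
  \<open>\<eta>\<close> to the power \<open>\<theta>\<^sub>2/t\<close> at most a constant times \<open>\<epsilon>\<close> to the power \<open>\<theta>\<^sub>1/s\<close>. Values of \<open>\<eta>\<close> away from
  \<open>0\<close> are reduced to one fixed exponent because the measure is finite.
\<close>

section \<open>Radial integrals\<close>

lemma nn_integral_powr_tail:
  fixes m v :: real
  assumes "m > 0" "v > 0"
  shows "(\<integral>\<^sup>+r. ennreal (m * r powr (- m - 1)) * indicator {v<..} r \<partial>lborel) = ennreal (v powr - m)"
proof -
  have "(\<integral>\<^sup>+r. ennreal (m * r powr (- m - 1)) * indicator {v<..} r \<partial>lborel)
      = (\<integral>\<^sup>+r. ennreal (m * r powr (- m - 1)) * indicator {v..} r \<partial>lborel)"
    using AE_lborel_singleton[of v] by (intro nn_integral_cong_AE) (auto simp: indicator_def)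
  also have "\<dots> = ennreal (0 - (- (v powr - m)))"
  proof (rule nn_integral_FTC_atLeast)
    show "(\<lambda>r. m * r powr (- m - 1)) \<in> borel_measurable borel" by measurable
    fix x assume "v \<le> x"
    then show "((\<lambda>r. - (r powr - m)) has_real_derivative m * x powr (- m - 1)) (at x)"
      using assms by (auto intro!: derivative_eq_intros)
    show "0 \<le> m * x powr (- m - 1)" using assms by auto
  next
    have "((\<lambda>r. r powr - m) \<longlongrightarrow> 0) at_top"
      using assms by (intro tendsto_neg_powr filterlim_ident) auto
    then show "((\<lambda>r. - (r powr - m)) \<longlongrightarrow> 0) at_top"
      by (auto dest: tendsto_minus)
  qed
  finally show ?thesis by simp
qed

text \<open>For \<open>a < 1\<close> the integrand blows up at 0, so the gauge integral of a power
  from 0 replaces a primitive differentiable up to the endpoint.\<close>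

lemma nn_integral_powr_head:
  fixes a c :: real
  assumes "a > 0" "c \<ge> 0"
  shows "(\<integral>\<^sup>+r. ennreal (a * r powr (a - 1)) * indicator {0<..<c} r \<partial>lborel) = ennreal (c powr a)"
proof -
  have "((\<lambda>x. x powr (a - 1)) has_integral (c powr (a - 1 + 1) / (a - 1 + 1))) {0..c}"
    using assms by (intro has_integral_powr_from_0) auto
  from has_integral_mult_right[OF this, of a]
  have "((\<lambda>x. a * x powr (a - 1)) has_integral (c powr a)) {0..c}"
    using assms by simp
  then have "(\<integral>\<^sup>+r. ennreal (a * r powr (a - 1) * indicator {0..c} r) \<partial>lborel) = ennreal (c powr a)"
  proof (intro nn_integral_has_integral_lborel)
    have "(\<lambda>r. a * r powr (a - 1) * indicator {0..c} r) = (\<lambda>r. if r \<in> {0..c} then a * r powr (a - 1) else 0)"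
      by (auto simp: indicator_def)
    then show "((\<lambda>r. a * r powr (a - 1) * indicator {0..c} r) has_integral c powr a) UNIV"
      using \<open>((\<lambda>x. a * x powr (a - 1)) has_integral (c powr a)) {0..c}\<close>
      by (simp only: has_integral_restrict_UNIV)
  qed (use assms in \<open>auto simp: indicator_def\<close>)
  moreover have "(\<integral>\<^sup>+r. ennreal (a * r powr (a - 1)) * indicator {0<..<c} r \<partial>lborel)
    = (\<integral>\<^sup>+r. ennreal (a * r powr (a - 1) * indicator {0..c} r) \<partial>lborel)"
    using AE_lborel_singleton[of c] AE_lborel_singleton[of 0]
    by (intro nn_integral_cong_AE, eventually_elim) (auto simp: indicator_def)
  ultimately show ?thesis by simp
qed

text \<open>Write \<open>w y powr - m\<close> as the integral of \<open>m * r powr (- m - 1)\<close>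
  over \<open>r > w y\<close> and exchange the integrals: the inner one becomes the mass of a ball,
  bounded by the growth condition. Convergence at infinity is \<open>\<kappa> < m\<close>.\<close>

lemma nn_integral_radial_tail:
  fixes w :: "'a \<Rightarrow> real" and F :: "'a \<Rightarrow> ennreal"
  assumes "sigma_finite_measure M"
    and [measurable]: "w \<in> borel_measurable M" "F \<in> borel_measurable M"
    and A: "A \<ge> 0" and m: "0 < m" "\<kappa> < m" and d: "\<delta> > 0"
    and growth: "\<And>r. r > 0 \<Longrightarrow> (\<integral>\<^sup>+y. F y * indicator {y. w y < r} y \<partial>M) \<le> ennreal (A * r powr \<kappa>)"
  shows "(\<integral>\<^sup>+y. F y * ennreal (w y powr - m) * indicator {y. \<delta> \<le> w y} y \<partial>M)
    \<le> ennreal (A * (m / (m - \<kappa>)) * \<delta> powr (\<kappa> - m))"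
proof -
  interpret M: sigma_finite_measure M by fact
  interpret pair_sigma_finite M lborel
    by (simp add: pair_sigma_finite_def sigma_finite_lborel assms)
  have "(\<integral>\<^sup>+y. F y * ennreal (w y powr - m) * indicator {y. \<delta> \<le> w y} y \<partial>M)
     = (\<integral>\<^sup>+y. \<integral>\<^sup>+r. F y * indicator {y. \<delta> \<le> w y} y *
          (ennreal (m * r powr (- m - 1)) * indicator {w y<..} r) \<partial>lborel \<partial>M)"
  proof (intro nn_integral_cong)
    fix y
    show "F y * ennreal (w y powr - m) * indicator {y. \<delta> \<le> w y} y
      = (\<integral>\<^sup>+r. F y * indicator {y. \<delta> \<le> w y} y *
          (ennreal (m * r powr (- m - 1)) * indicator {w y<..} r) \<partial>lborel)"
      using nn_integral_powr_tail[OF m(1), of "w y"] d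
      by (subst nn_integral_cmult) (auto simp: indicator_def)
  qed
  also have "\<dots> = (\<integral>\<^sup>+r. \<integral>\<^sup>+y. F y * indicator {y. \<delta> \<le> w y} y *
          (ennreal (m * r powr (- m - 1)) * indicator {w y<..} r) \<partial>M \<partial>lborel)"
    by (subst Fubini') (auto simp: indicator_def)
  also have "\<dots> \<le> (\<integral>\<^sup>+r. ennreal (A * (m / (m - \<kappa>))) * (ennreal ((m - \<kappa>) * r powr (- (m - \<kappa>) - 1)) * indicator {\<delta><..} r) \<partial>lborel)"
  proof (intro nn_integral_mono)
    fix r :: real
    show "(\<integral>\<^sup>+y. F y * indicator {y. \<delta> \<le> w y} y *
          (ennreal (m * r powr (- m - 1)) * indicator {w y<..} r) \<partial>M)
       \<le> ennreal (A * (m / (m - \<kappa>))) * (ennreal ((m - \<kappa>) * r powr (- (m - \<kappa>) - 1)) * indicator {\<delta><..} r)"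
    proof (cases "r > \<delta>")
      case False
      then have "(\<integral>\<^sup>+y. F y * indicator {y. \<delta> \<le> w y} y *
          (ennreal (m * r powr (- m - 1)) * indicator {w y<..} r) \<partial>M) = (\<integral>\<^sup>+y. 0 \<partial>M)"
        by (intro nn_integral_cong) (auto simp: indicator_def)
      then show ?thesis by simp
    next
      case True
      have "(\<integral>\<^sup>+y. F y * indicator {y. \<delta> \<le> w y} y *
          (ennreal (m * r powr (- m - 1)) * indicator {w y<..} r) \<partial>M)
         \<le> (\<integral>\<^sup>+y. ennreal (m * r powr (- m - 1)) * (F y * indicator {y. w y < r} y) \<partial>M)"
        by (intro nn_integral_mono) (auto simp: indicator_def ac_simps)
      also have "\<dots> = ennreal (m * r powr (- m - 1)) * (\<integral>\<^sup>+y. F y * indicator {y. w y < r} y \<partial>M)"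
        by (subst nn_integral_cmult) auto
      also have "\<dots> \<le> ennreal (m * r powr (- m - 1)) * ennreal (A * r powr \<kappa>)"
        using True d by (intro mult_left_mono growth) auto
      also have "\<dots> = ennreal (A * (m / (m - \<kappa>))) * ennreal ((m - \<kappa>) * r powr (- (m - \<kappa>) - 1))"
      proof -
        have "r powr (- m - 1) * r powr \<kappa> = r powr (- (m - \<kappa>) - 1)"
          by (simp flip: powr_add add: algebra_simps)
        then have "m * r powr (- m - 1) * (A * r powr \<kappa>) = A * (m / (m - \<kappa>)) * ((m - \<kappa>) * r powr (- (m - \<kappa>) - 1))"
          using m by (simp add: field_simps)
        then show ?thesis using m A by (simp flip: ennreal_mult)
      qed
      finally show ?thesis using True by simp
    qed
  qed
  also have "\<dots> = ennreal (A * (m / (m - \<kappa>))) * ennreal (\<delta> powr - (m - \<kappa>))"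
    using nn_integral_powr_tail[of "m - \<kappa>" \<delta>] m d by (subst nn_integral_cmult) auto
  also have "\<dots> = ennreal (A * (m / (m - \<kappa>)) * \<delta> powr (\<kappa> - m))"
    using m A by (simp flip: ennreal_mult)
  finally show ?thesis .
qed

text \<open>The same exchange near the centre. Radii below \<delta> give a power integrable at 0
  since \<open>m < \<kappa>\<close>; for larger radii the mass stays that of the \<delta>-ball,
  which gives the second integral \<open>?t\<close>.\<close>

lemma nn_integral_radial_head:
  fixes w :: "'a \<Rightarrow> real" and F :: "'a \<Rightarrow> ennreal"
  assumes "sigma_finite_measure M"
    and [measurable]: "w \<in> borel_measurable M" "F \<in> borel_measurable M"
    and w: "\<And>y. 0 \<le> w y"
    and A: "A \<ge> 0" and m: "0 < m" "m < \<kappa>" and d: "\<delta> > 0"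
    and growth: "\<And>r. r > 0 \<Longrightarrow> (\<integral>\<^sup>+y. F y * indicator {y. w y < r} y \<partial>M) \<le> ennreal (A * r powr \<kappa>)"
  shows "(\<integral>\<^sup>+y. F y * ennreal (w y powr - m) * indicator {y. w y < \<delta>} y \<partial>M)
    \<le> ennreal (A * (\<kappa> / (\<kappa> - m)) * \<delta> powr (\<kappa> - m))"
proof -
  interpret M: sigma_finite_measure M by fact
  interpret pair_sigma_finite M lborel
    by (simp add: pair_sigma_finite_def sigma_finite_lborel assms)
  let ?J = "\<lambda>y r. F y * indicator {y. w y < \<delta>} y * (ennreal (m * r powr (- m - 1)) * indicator {w y<..} r)"
  let ?h = "\<lambda>r. ennreal (A * (m / (\<kappa> - m))) * (ennreal ((\<kappa> - m) * r powr ((\<kappa> - m) - 1)) * indicator {0<..<\<delta>} r)"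
  let ?t = "\<lambda>r. ennreal (A * \<delta> powr \<kappa>) * (ennreal (m * r powr (- m - 1)) * indicator {\<delta><..} r)"
  have "(\<integral>\<^sup>+y. F y * ennreal (w y powr - m) * indicator {y. w y < \<delta>} y \<partial>M)
     \<le> (\<integral>\<^sup>+y. \<integral>\<^sup>+r. ?J y r * indicator {0<..} r \<partial>lborel \<partial>M)"
  proof (intro nn_integral_mono)
    fix y
    show "F y * ennreal (w y powr - m) * indicator {y. w y < \<delta>} y \<le> (\<integral>\<^sup>+r. ?J y r * indicator {0<..} r \<partial>lborel)"
    \<comment> \<open>Where \<open>w\<close> vanishes, \<open>0 powr - m\<close> is 0, so the left
      side is 0; this is why only an inequality is claimed.\<close>
    proof (cases "w y = 0")
      case False
      then have wy: "w y > 0" using w[of y] by simp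
      have "(\<integral>\<^sup>+r. ?J y r * indicator {0<..} r \<partial>lborel) = (\<integral>\<^sup>+r. ?J y r \<partial>lborel)"
        using wy by (intro nn_integral_cong) (auto simp: indicator_def)
      also have "\<dots> = F y * ennreal (w y powr - m) * indicator {y. w y < \<delta>} y"
        using nn_integral_powr_tail[OF m(1) wy]
        by (subst nn_integral_cmult) (auto simp: indicator_def)
      finally show ?thesis by simp
    qed auto
  qed
  also have "\<dots> = (\<integral>\<^sup>+r. \<integral>\<^sup>+y. ?J y r * indicator {0<..} r \<partial>M \<partial>lborel)"
    by (subst Fubini') (auto simp: indicator_def)
  also have "\<dots> \<le> (\<integral>\<^sup>+r. ?h r + ?t r \<partial>lborel)"
  \<comment> \<open>The radius \<delta> belongs to neither of the open ranges in \<open>?h\<close>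
    and \<open>?t\<close>, so it is discarded as a null set.\<close>
  proof (rule nn_integral_mono_AE, rule AE_mp[OF AE_lborel_singleton[of \<delta>] AE_I2], rule impI)
    fix r :: real
    assume "r \<noteq> \<delta>"
    show "(\<integral>\<^sup>+y. ?J y r * indicator {0<..} r \<partial>M) \<le> ?h r + ?t r"
    proof (cases "r > 0")
      case False
      then show ?thesis by simp
    next
      case True
      have "(\<integral>\<^sup>+y. ?J y r * indicator {0<..} r \<partial>M)
         \<le> (\<integral>\<^sup>+y. ennreal (m * r powr (- m - 1)) * (F y * indicator {y. w y < min r \<delta>} y) \<partial>M)"
        by (intro nn_integral_mono) (auto simp: indicator_def ac_simps)
      also have "\<dots> = ennreal (m * r powr (- m - 1)) * (\<integral>\<^sup>+y. F y * indicator {y. w y < min r \<delta>} y \<partial>M)"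
        by (subst nn_integral_cmult) auto
      also have "\<dots> \<le> ennreal (m * r powr (- m - 1)) * ennreal (A * min r \<delta> powr \<kappa>)"
        using True d by (intro mult_left_mono growth) auto
      also have "\<dots> \<le> ?h r + ?t r"
      proof (cases "r < \<delta>")
        case lt: True
        have "r powr (- m - 1) * r powr \<kappa> = r powr ((\<kappa> - m) - 1)"
          by (simp flip: powr_add add: algebra_simps)
        then have "m * r powr (- m - 1) * (A * r powr \<kappa>) = A * (m / (\<kappa> - m)) * ((\<kappa> - m) * r powr ((\<kappa> - m) - 1))"
          using m by (simp add: field_simps)
        then have "ennreal (m * r powr (- m - 1)) * ennreal (A * min r \<delta> powr \<kappa>) = ?h r"
          using m A lt True by (simp flip: ennreal_mult)
        then show ?thesis by simp
      next
        case False
        then have "ennreal (m * r powr (- m - 1)) * ennreal (A * min r \<delta> powr \<kappa>) = ?t r"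
          using \<open>r \<noteq> \<delta>\<close> by (simp add: mult.commute)
        then show ?thesis by simp
      qed
      finally show ?thesis .
    qed
  qed
  also have "\<dots> = ennreal (A * (m / (\<kappa> - m))) * ennreal (\<delta> powr (\<kappa> - m)) + ennreal (A * \<delta> powr \<kappa>) * ennreal (\<delta> powr - m)"
    using nn_integral_powr_tail[of m \<delta>] nn_integral_powr_head[of "\<kappa> - m" \<delta>] m d
    by (subst nn_integral_add) (auto simp: nn_integral_cmult)
  also have "\<dots> = ennreal (A * (m / (\<kappa> - m)) * \<delta> powr (\<kappa> - m) + A * \<delta> powr (\<kappa> - m))"
  proof -
    have "\<delta> powr \<kappa> * \<delta> powr - m = \<delta> powr (\<kappa> - m)" by (simp flip: powr_add)
    then show ?thesis using m A by (simp flip: ennreal_mult ennreal_plus add: mult.assoc)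
  qed
  also have "A * (m / (\<kappa> - m)) * \<delta> powr (\<kappa> - m) + A * \<delta> powr (\<kappa> - m) = A * (\<kappa> / (\<kappa> - m)) * \<delta> powr (\<kappa> - m)"
    using m by (simp add: field_simps)
  finally show ?thesis .
qed

section \<open>Nets and measurable kernels\<close>

context homogeneous_space
begin

section \<open>Constants, finiteness of the measure, measurable sections\<close>

lemma quasi_metric_const:
  obtains K where "K \<ge> 1" "\<And>x y z. \<rho> x y \<le> K * (\<rho> x z + \<rho> z y)" "\<And>x y. \<rho> x y \<le> K * \<rho> y x"
proof -
  obtain a\<^sub>1 where a1: "\<And>x y z. \<rho> x y \<le> a\<^sub>1 * (\<rho> x z + \<rho> z y)" using quasi_triangle by blast
  obtain a\<^sub>0 where a0: "\<And>x y. \<rho> x y \<le> a\<^sub>0 * \<rho> y x" using quasi_symmetric by blast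
  define K where "K = max 1 (max a\<^sub>1 a\<^sub>0)"
  have "\<rho> x y \<le> K * (\<rho> x z + \<rho> z y)" for x y z
    by (rule order_trans[OF a1[of x y z]])
       (intro mult_right_mono add_nonneg_nonneg rho_nonneg, auto simp: K_def)
  moreover have "\<rho> x y \<le> K * \<rho> y x" for x y
    by (rule order_trans[OF a0[of x y]]) (intro mult_right_mono rho_nonneg, auto simp: K_def)
  moreover have "K \<ge> 1" by (simp add: K_def)
  ultimately show ?thesis using that by blast
qed

lemma rho_le_qdiam: "\<rho> x y \<le> qdiam \<rho>"
  unfolding qdiam_def using diam_finite by (intro cSup_upper) auto

lemma qball_UNIV: "r > qdiam \<rho> \<Longrightarrow> qball \<rho> x r = UNIV"
  using rho_le_qdiam[of x] by (auto simp: qball_def intro: le_less_trans)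

text \<open>Diameter 0 would make the space a single point, which is a null set, while balls have
  positive measure.\<close>

lemma qdiam_pos: "qdiam \<rho> > 0"
proof (rule ccontr)
  assume "\<not> qdiam \<rho> > 0"
  then have 0: "\<rho> x y = 0" for x y using rho_le_qdiam[of x y] rho_nonneg[of x y] by linarith
  then have "qball \<rho> undefined 1 = {undefined}" using rho_eq_0_iff by (auto simp: qball_def 0)
  then show False using qball_pos[of 1 undefined] singleton_null[of undefined] by (simp add: null_sets_def)
qed

lemma finite_measure_M: "finite_measure M"
proof
  show "emeasure M (space M) \<noteq> \<infinity>"
    using qball_finite[of "qdiam \<rho> + 1" undefined] qball_UNIV[of "qdiam \<rho> + 1" undefined] qdiam_pos
    by (simp add: space_M)
qed

lemma rho_measurable [measurable]: "\<rho> x \<in> borel_measurable M"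
proof (rule borel_measurableI_less)
  fix r
  have "{y \<in> space M. \<rho> x y < r} = (if r > 0 then qball \<rho> x r else {})"
    using rho_nonneg[of x] by (auto simp: qball_def space_M intro: order_trans le_less_trans)
  then show "{y \<in> space M. \<rho> x y < r} \<in> sets M" using qball_sets by simp
qed

section \<open>Packing and finite nets\<close>

lemma doubling_iterate:
  obtains c where "c \<ge> 1"
    "\<And>n x r. r > 0 \<Longrightarrow> emeasure M (qball \<rho> x (2 ^ n * r)) \<le> ennreal (c ^ n) * emeasure M (qball \<rho> x r)"
proof -
  obtain c' where c': "\<And>x r. r > 0 \<Longrightarrow> emeasure M (qball \<rho> x (2 * r)) \<le> ennreal c' * emeasure M (qball \<rho> x r)"
    using doubling by blast
  define c where "c = max 1 c'"
  have c: "emeasure M (qball \<rho> x (2 * r)) \<le> ennreal c * emeasure M (qball \<rho> x r)" if "r > 0" for x r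
    by (rule order_trans[OF c'[OF that]]) (intro mult_right_mono ennreal_leI, auto simp: c_def)
  have "emeasure M (qball \<rho> x (2 ^ n * r)) \<le> ennreal (c ^ n) * emeasure M (qball \<rho> x r)" if "r > 0" for n x r
  proof (induction n)
    case (Suc n)
    have "emeasure M (qball \<rho> x (2 ^ Suc n * r)) \<le> ennreal c * emeasure M (qball \<rho> x (2 ^ n * r))"
      using c[of "2 ^ n * r" x] that by (simp add: mult.assoc)
    also have "\<dots> \<le> ennreal c * (ennreal (c ^ n) * emeasure M (qball \<rho> x r))"
      by (intro mult_left_mono Suc) auto
    also have "\<dots> = ennreal (c ^ Suc n) * emeasure M (qball \<rho> x r)"
      by (simp add: c_def ennreal_mult mult.assoc)
    finally show ?case .
  qed simp
  moreover have "c \<ge> 1" by (simp add: c_def)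
  ultimately show ?thesis using that by blast
qed

text \<open>A packing argument: small balls about separated points are disjoint, while doubling,
  iterated until the radius exceeds the diameter, gives each of them at least the fraction
  \<open>1 / c ^ n\<close> of the finite total mass.\<close>

lemma separated_card_bounded:
  assumes "\<delta> > 0"
  obtains N :: real where "\<And>Q. finite Q \<Longrightarrow> (\<And>x y. x \<in> Q \<Longrightarrow> y \<in> Q \<Longrightarrow> x \<noteq> y \<Longrightarrow> \<delta> \<le> \<rho> x y) \<Longrightarrow> card Q \<le> N"
proof -
  obtain K where K: "K \<ge> 1" "\<And>x y z. \<rho> x y \<le> K * (\<rho> x z + \<rho> z y)" "\<And>x y. \<rho> x y \<le> K * \<rho> y x"
    by (rule quasi_metric_const) blast
  obtain c where c: "c \<ge> 1" "\<And>n x r. r > 0 \<Longrightarrow> emeasure M (qball \<rho> x (2 ^ n * r)) \<le> ennreal (c ^ n) * emeasure M (qball \<rho> x r)"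
    by (rule doubling_iterate) blast
  interpret finite_measure M by (rule finite_measure_M)
  \<comment> \<open>Two points whose \<open>e\<close>-balls meet are closer than
    \<open>K * (e + K * e)\<close>, where the inner \<open>K\<close> reverses the second distance;
    this is at most \<open>2 * K\<^sup>2 * e\<close>, which is \<delta>.\<close>
  define e where "e = \<delta> / (2 * K\<^sup>2)"
  have e: "e > 0" using assms K(1) by (simp add: e_def)
  obtain n where n: "qdiam \<rho> / e < 2 ^ n" using real_arch_pow[of 2 "qdiam \<rho> / e"] by auto
  then have n: "2 ^ n * e > qdiam \<rho>" using e by (simp add: field_simps)
  have mpos: "measure M UNIV > 0"
    using qball_pos[of "qdiam \<rho> + 1" undefined] qball_UNIV[of "qdiam \<rho> + 1" undefined] qdiam_pos
    by (simp add: emeasure_eq_measure)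
  have "card Q \<le> c ^ n" if Q: "finite Q" "\<And>x y. x \<in> Q \<Longrightarrow> y \<in> Q \<Longrightarrow> x \<noteq> y \<Longrightarrow> \<delta> \<le> \<rho> x y" for Q
  proof -
    have disj: "disjoint_family_on (\<lambda>x. qball \<rho> x e) Q"
      unfolding disjoint_family_on_def
    proof (intro ballI impI)
      fix x y assume xy: "x \<in> Q" "y \<in> Q" "x \<noteq> y"
      have False if "\<rho> x z < e" "\<rho> y z < e" for z
      proof -
        have "\<rho> z y \<le> K * \<rho> y z" by (rule K)
        also have "\<dots> < K * e" using K(1) that by simp
        finally have "\<rho> x z + \<rho> z y < e + K * e" using that by simp
        then have "\<rho> x y < K * (e + K * e)"
          using K(1) by (intro le_less_trans[OF K(2)[of x y z]]) simp
        also have "K * (e + K * e) \<le> K * (K * e + K * e)" using K(1) e by simp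
        also have "\<dots> = \<delta>" using K(1) by (simp add: e_def power2_eq_square field_simps)
        finally show False using Q(2)[OF xy] by simp
      qed
      then show "qball \<rho> x e \<inter> qball \<rho> y e = {}" by (auto simp: qball_def)
    qed
    have "measure M UNIV \<le> c ^ n * measure M (qball \<rho> x e)" for x
      using c(2)[OF e, of x n] qball_UNIV[OF n] c(1) by (simp add: emeasure_eq_measure flip: ennreal_mult)
    then have "card Q * measure M UNIV \<le> (\<Sum>x\<in>Q. c ^ n * measure M (qball \<rho> x e))"
      using sum_mono[of Q "\<lambda>_. measure M UNIV"] by simp
    also have "\<dots> = c ^ n * measure M (\<Union>x\<in>Q. qball \<rho> x e)"
      using finite_measure_finite_Union[OF Q(1) _ disj] qball_sets[OF e] by (simp add: sum_distrib_left image_subset_iff)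
    also have "\<dots> \<le> c ^ n * measure M UNIV"
      using c(1) bounded_measure[unfolded space_M] by (intro mult_left_mono) auto
    finally show ?thesis using mpos by (rule mult_right_le_imp_le)
  qed
  then show ?thesis using that by blast
qed

text \<open>A separated set of maximal cardinality is a net. Failure to enlarge it gives closeness
  in only one of the two orders of arguments, so separation is taken at \<open>\<delta> / K\<close>
  to allow for reversing them.\<close>

lemma finite_net:
  assumes "\<delta> > 0"
  obtains Q where "finite Q" "\<And>x. \<exists>z\<in>Q. \<rho> z x < \<delta>"
proof -
  obtain K where K: "K \<ge> 1" "\<And>x y. \<rho> x y \<le> K * \<rho> y x"
    by (rule quasi_metric_const) blast
  define e where "e = \<delta> / K"
  have e: "e > 0" "e \<le> \<delta>" using assms K(1) by (auto simp: e_def divide_simps)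
  define P where "P Q \<longleftrightarrow> finite Q \<and> (\<forall>x\<in>Q. \<forall>y\<in>Q. x \<noteq> y \<longrightarrow> e \<le> \<rho> x y)" for Q
  obtain N :: real where N: "\<And>Q. finite Q \<Longrightarrow> (\<And>x y. x \<in> Q \<Longrightarrow> y \<in> Q \<Longrightarrow> x \<noteq> y \<Longrightarrow> e \<le> \<rho> x y) \<Longrightarrow> card Q \<le> N"
    by (rule separated_card_bounded[OF e(1)]) blast
  have "card Q < Suc (nat \<lceil>N\<rceil>)" if "P Q" for Q
  proof -
    have "real (card Q) \<le> N" using that by (intro N) (auto simp: P_def)
    then show ?thesis by linarith
  qed
  then have bd: "\<forall>Q. P Q \<longrightarrow> card Q < Suc (nat \<lceil>N\<rceil>)" by blast
  have "P {}" by (simp add: P_def)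
  from ex_has_greatest_nat[OF this bd]
  obtain Q where Q: "P Q" "\<And>Q'. P Q' \<Longrightarrow> card Q' \<le> card Q" by blast
  have "\<exists>z\<in>Q. \<rho> z x < \<delta>" for x
  proof (cases "x \<in> Q")
    case True
    then show ?thesis using assms rho_eq_0_iff[of x x] by (intro bexI[of _ x]) auto
  next
    case False
    have "\<not> P (insert x Q)" using Q(2)[of "insert x Q"] Q(1) False by (auto simp: P_def)
    then obtain z where z: "z \<in> Q" "\<rho> z x < e \<or> \<rho> x z < e"
      using Q(1) unfolding P_def by (auto simp: not_le)
    moreover have "\<rho> z x < \<delta>" if "\<rho> x z < e"
    proof -
      have "\<rho> z x \<le> K * \<rho> x z" by (rule K)
      also have "\<dots> < K * e" using that K(1) by simp
      finally show ?thesis using K(1) by (simp add: e_def)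
    qed
    ultimately show ?thesis using e(2) by (meson less_le_trans)
  qed
  then show ?thesis using that Q(1) by (auto simp: P_def)
qed

section \<open>A jointly measurable substitute for the quasi-metric\<close>

lemma measurable_entourage:
  obtains C where "C \<ge> 1" "\<And>\<delta>. \<delta> > 0 \<Longrightarrow> \<exists>E\<in>sets (M \<Otimes>\<^sub>M M). \<forall>x y. (\<rho> x y < \<delta> \<longrightarrow> (x, y) \<in> E) \<and> ((x, y) \<in> E \<longrightarrow> \<rho> x y < C * \<delta>)"
proof -
  obtain K where K: "K \<ge> 1" "\<And>x y z. \<rho> x y \<le> K * (\<rho> x z + \<rho> z y)" "\<And>x y. \<rho> x y \<le> K * \<rho> y x"
    by (rule quasi_metric_const) blast
  have "\<exists>E\<in>sets (M \<Otimes>\<^sub>M M). \<forall>x y. (\<rho> x y < \<delta> \<longrightarrow> (x, y) \<in> E) \<and> ((x, y) \<in> E \<longrightarrow> \<rho> x y < 4 * K ^ 3 * \<delta>)"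
    if d: "\<delta> > 0" for \<delta>
  proof -
    obtain Q where Q: "finite Q" "\<And>x. \<exists>z\<in>Q. \<rho> z x < \<delta>" by (rule finite_net[OF d]) blast
    \<comment> \<open>If \<open>\<rho> x y < \<delta>\<close>, a net point near \<open>x\<close> is
      within \<open>2 * K * \<delta>\<close> of both points, so the squares of these balls cover all
      such pairs. They are finitely many measurable rectangles, so their union is product measurable
      even if \<rho> is not.\<close>
    let ?B = "\<lambda>z. qball \<rho> z (2 * K * \<delta>)"
    have "K * \<delta> > 0" using K(1) d by simp
    then have "(\<Union>z\<in>Q. ?B z \<times> ?B z) \<in> sets (M \<Otimes>\<^sub>M M)"
      using Q(1) by (intro sets.finite_UN pair_measureI qball_sets) auto
    moreover have "(x, y) \<in> (\<Union>z\<in>Q. ?B z \<times> ?B z)" if "\<rho> x y < \<delta>" for x y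
    proof -
      obtain z where z: "z \<in> Q" "\<rho> z x < \<delta>" using Q(2) by blast
      have "K * (\<rho> z x + \<rho> x y) < K * (2 * \<delta>)" using z that K(1) by (intro mult_strict_left_mono) auto
      then have "\<rho> z y < 2 * K * \<delta>" using K(2)[of z y x] by simp
      moreover have "\<delta> \<le> K * \<delta>" using K(1) d by simp
      ultimately have "\<rho> z x < 2 * K * \<delta>" "\<rho> z y < 2 * K * \<delta>" using z d by linarith+
      then show ?thesis using z(1) by (auto simp: qball_def)
    qed
    moreover have "\<rho> x y < 4 * K ^ 3 * \<delta>" if xy: "(x, y) \<in> (\<Union>z\<in>Q. ?B z \<times> ?B z)" for x y
    proof -
      obtain z where z: "\<rho> z x < 2 * K * \<delta>" "\<rho> z y < 2 * K * \<delta>" using xy by (auto simp: qball_def)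
      have "\<rho> x z \<le> K * \<rho> z x" by (rule K)
      also have "\<dots> < K * (2 * K * \<delta>)" using K(1) z by (intro mult_strict_left_mono) auto
      finally have 1: "\<rho> x z < K * (2 * K * \<delta>)" .
      have 2: "2 * K * \<delta> \<le> K * (2 * K * \<delta>)" using K(1) d by simp
      have "\<rho> x y \<le> K * (\<rho> x z + \<rho> z y)" by (rule K)
      also have "\<dots> < K * (K * (2 * K * \<delta>) + K * (2 * K * \<delta>))"
        using K(1) by (intro mult_strict_left_mono add_strict_mono[OF 1] less_le_trans[OF z(2) 2]) auto
      finally show ?thesis by (simp add: power3_eq_cube ac_simps)
    qed
    ultimately show ?thesis by blast
  qed
  moreover have "4 * K ^ 3 \<ge> 1" using one_le_power[OF K(1), of 3] by linarith
  ultimately show ?thesis using that by blast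
qed

text \<open>The quasi-metric need not be jointly measurable, so Tonelli's theorem is only available for an
  equivalent kernel.\<close>

lemma measurable_comparison:
  obtains \<sigma> L where "(\<lambda>(x, y). \<sigma> x y) \<in> borel_measurable (M \<Otimes>\<^sub>M M)" "L \<ge> 1"
    "\<And>x y. \<rho> x y \<le> \<sigma> x y" "\<And>x y. \<sigma> x y \<le> L * \<rho> x y"
proof -
  obtain C where C: "C \<ge> 1" "\<And>\<delta>. \<delta> > 0 \<Longrightarrow> \<exists>E\<in>sets (M \<Otimes>\<^sub>M M). \<forall>x y. (\<rho> x y < \<delta> \<longrightarrow> (x, y) \<in> E) \<and> ((x, y) \<in> E \<longrightarrow> \<rho> x y < C * \<delta>)"
    by (rule measurable_entourage) blast
  define D where "D = qdiam \<rho> + 1"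
  define d where "d k = D / 2 ^ k" for k :: nat
  have D: "D > 0" using qdiam_pos by (simp add: D_def)
  then have d: "d k > 0" for k by (simp add: d_def)
  have "\<exists>E\<in>sets (M \<Otimes>\<^sub>M M). \<forall>x y. (\<rho> x y < d k \<longrightarrow> (x, y) \<in> E) \<and> ((x, y) \<in> E \<longrightarrow> \<rho> x y < C * d k)" for k
    by (rule C(2)[OF d])
  then obtain E where E [measurable]: "\<And>k. E k \<in> sets (M \<Otimes>\<^sub>M M)"
    and E1: "\<And>k x y. \<rho> x y < d k \<Longrightarrow> (x, y) \<in> E k" and E2: "\<And>k x y. (x, y) \<in> E k \<Longrightarrow> \<rho> x y < C * d k"
    by metis
  \<comment> \<open>\<open>E k\<close> contains all pairs closer than \<open>d k\<close>, so each
    \<open>s k\<close> is a measurable minorant of \<rho>. By \<open>E2\<close>, their supremum is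
    also comparable to \<rho> from below.\<close>
  define s where "s k z = (if z \<in> E k then 0 else d k)" for k and z :: "'a \<times> 'a"
  have s_le: "s k (x, y) \<le> \<rho> x y" for k x y
    using E1[of x y k] rho_nonneg[of x y] by (auto simp: s_def intro: leI)
  have bdd: "bdd_above (range (\<lambda>k. s k (x, y)))" for x y
    by (rule bdd_aboveI2[of _ _ "\<rho> x y"]) (rule s_le)
  define \<sigma>0 where "\<sigma>0 x y = (SUP k. s k (x, y))" for x y
  have "(\<lambda>z. SUP k. s k z) \<in> borel_measurable (M \<Otimes>\<^sub>M M)"
  proof (rule borel_measurable_cSUP)
    show "s k \<in> borel_measurable (M \<Otimes>\<^sub>M M)" for k unfolding s_def by measurable
    show "bdd_above (range (\<lambda>k. s k z))" for z using bdd[of "fst z" "snd z"] by simp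
  qed auto
  then have meas: "(\<lambda>(x, y). \<sigma>0 x y) \<in> borel_measurable (M \<Otimes>\<^sub>M M)" by (simp add: \<sigma>0_def split_beta')
  have le: "\<sigma>0 x y \<le> \<rho> x y" for x y unfolding \<sigma>0_def by (rule cSUP_least) (auto intro: s_le)
  have ge: "\<rho> x y \<le> 2 * C * \<sigma>0 x y" for x y
  proof (cases "\<rho> x y = 0")
    case True
    have "0 \<le> s 0 (x, y)" using d[of 0] by (simp add: s_def)
    also have "\<dots> \<le> \<sigma>0 x y" unfolding \<sigma>0_def by (intro cSUP_upper bdd) simp
    finally show ?thesis using True C by simp
  next
    case False
    then have pos: "\<rho> x y > 0" using rho_nonneg[of x y] by simp
    obtain n where "C * D / \<rho> x y < 2 ^ n" using real_arch_pow[of 2 "C * D / \<rho> x y"] by auto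
    then have ex: "C * d n \<le> \<rho> x y" using pos by (simp add: d_def field_simps)
    \<comment> \<open>At the first scale with \<open>C * d k \<le> \<rho> x y\<close> the pair lies
      outside \<open>E k\<close>, so \<open>s k\<close> equals \<open>d k\<close>; the previous
      scale, twice as large, failed, which bounds \<rho> by \<open>2 * C * d k\<close>. The first
      scale is not 0 because \<open>C * d 0\<close> exceeds the diameter.\<close>
    define k where "k = (LEAST k. C * d k \<le> \<rho> x y)"
    have k: "C * d k \<le> \<rho> x y" unfolding k_def by (rule LeastI[of _ n]) (rule ex)
    have "\<rho> x y < D" using rho_le_qdiam[of x y] by (simp add: D_def)
    also have "D \<le> C * d 0" using C(1) D by (simp add: d_def)
    finally obtain j where j: "k = Suc j" using k by (cases k) auto
    have "\<not> C * d j \<le> \<rho> x y" using j not_less_Least[of j "\<lambda>k. C * d k \<le> \<rho> x y"] by (simp add: k_def)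
    then have "\<rho> x y \<le> 2 * C * d k" using j by (simp add: d_def)
    moreover have "d k = s k (x, y)" using E2[of x y k] k by (auto simp: s_def)
    moreover have "s k (x, y) \<le> \<sigma>0 x y" unfolding \<sigma>0_def by (intro cSUP_upper bdd) simp
    then have "2 * C * s k (x, y) \<le> 2 * C * \<sigma>0 x y" using C(1) by (intro mult_left_mono) auto
    ultimately show ?thesis by simp
  qed
  show ?thesis
  proof (rule that[of "\<lambda>x y. 2 * C * \<sigma>0 x y" "2 * C"])
    show "(\<lambda>(x, y). 2 * C * \<sigma>0 x y) \<in> borel_measurable (M \<Otimes>\<^sub>M M)" using meas by (simp add: split_beta')
  qed (use C ge le in auto)
qed

text \<open>Points at distance exactly \<open>qdiam \<rho>\<close> lie in no ball of smaller radius, so the case of large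
  \<open>r\<close> needs a covering by small balls.\<close>

lemma growth_all_radii:
  obtains c :: real where "c \<ge> 1"
    "\<And>F A \<kappa> x r. F \<in> borel_measurable M \<Longrightarrow> A \<ge> 0 \<Longrightarrow> \<kappa> \<ge> 0 \<Longrightarrow>
       (\<And>x r. 0 < r \<Longrightarrow> r < qdiam \<rho> \<Longrightarrow> (\<integral>\<^sup>+y\<in>qball \<rho> x r. F y \<partial>M) \<le> ennreal (A * r powr \<kappa>)) \<Longrightarrow>
       r > 0 \<Longrightarrow> (\<integral>\<^sup>+y\<in>qball \<rho> x r. F y \<partial>M) \<le> ennreal (c * A * r powr \<kappa>)"
proof -
  \<comment> \<open>Net balls of half the diameter fall under the hypothesis, and in the case of
    large \<open>r\<close> their radius is below \<open>r\<close>.\<close>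
  define \<delta> where "\<delta> = qdiam \<rho> / 2"
  have d: "\<delta> > 0" "\<delta> < qdiam \<rho>" using qdiam_pos by (auto simp: \<delta>_def)
  obtain Q where Q: "finite Q" "\<And>x. \<exists>z\<in>Q. \<rho> z x < \<delta>" by (rule finite_net[OF d(1)]) blast
  then have card: "real (card Q) \<ge> 1"
    by (metis One_nat_def Suc_leI card_gt_0_iff empty_iff of_nat_1 of_nat_le_iff)
  have "(\<integral>\<^sup>+y\<in>qball \<rho> x r. F y \<partial>M) \<le> ennreal (real (card Q) * A * r powr \<kappa>)"
    if F [measurable]: "F \<in> borel_measurable M" and A: "A \<ge> 0" "\<kappa> \<ge> 0" and r: "r > 0"
      and bd: "\<And>x r. 0 < r \<Longrightarrow> r < qdiam \<rho> \<Longrightarrow> (\<integral>\<^sup>+y\<in>qball \<rho> x r. F y \<partial>M) \<le> ennreal (A * r powr \<kappa>)"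
    for F A \<kappa> x r
  proof (cases "r < qdiam \<rho>")
    case True
    have "A * r powr \<kappa> \<le> card Q * (A * r powr \<kappa>)"
      using mult_right_mono[OF card, of "A * r powr \<kappa>"] A by simp
    then show ?thesis
      using bd[OF r True, of x] by (auto intro: order_trans ennreal_leI simp: mult.assoc)
  next
    case False
    have meas: "(\<lambda>y. F y * indicator (qball \<rho> z \<delta>) y) \<in> borel_measurable M" for z
      using qball_sets[OF d(1), of z] by measurable
    have "(\<integral>\<^sup>+y\<in>qball \<rho> x r. F y \<partial>M) \<le> (\<integral>\<^sup>+y. (\<Sum>z\<in>Q. F y * indicator (qball \<rho> z \<delta>) y) \<partial>M)"
    proof (intro nn_integral_mono)
      fix y
      obtain z where z: "z \<in> Q" "\<rho> z y < \<delta>" using Q(2) by blast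
      have "F y * indicator (qball \<rho> x r) y \<le> F y * indicator (qball \<rho> z \<delta>) y"
        using z by (auto simp: qball_def indicator_def)
      also have "\<dots> \<le> (\<Sum>z\<in>Q. F y * indicator (qball \<rho> z \<delta>) y)"
        using z Q by (intro member_le_sum) auto
      finally show "F y * indicator (qball \<rho> x r) y \<le> (\<Sum>z\<in>Q. F y * indicator (qball \<rho> z \<delta>) y)" .
    qed
    also have "\<dots> = (\<Sum>z\<in>Q. \<integral>\<^sup>+y\<in>qball \<rho> z \<delta>. F y \<partial>M)"
      by (rule nn_integral_sum) (rule meas)
    also have "\<dots> \<le> (\<Sum>z\<in>Q. ennreal (A * \<delta> powr \<kappa>))"
      by (intro sum_mono bd d)
    also have "\<dots> = ennreal (card Q * (A * \<delta> powr \<kappa>))"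
      using A by (simp add: ennreal_mult ennreal_of_nat_eq_real_of_nat)
    also have "\<dots> \<le> ennreal (card Q * (A * r powr \<kappa>))"
      using A d False by (intro ennreal_leI mult_left_mono powr_mono2) auto
    finally show ?thesis by (simp add: mult.assoc)
  qed
  then show ?thesis by (rule that[OF card])
qed

end

section \<open>Strong type estimate\<close>

text \<open>Joint measurability makes Tonelli's theorem available. \<sigma> is not assumed
  symmetric, so growth is required in each variable: in \<open>y\<close> for the pointwise bounds,
  in \<open>x\<close> after the order of integration is exchanged.\<close>

locale fractional_kernel = sigma_finite_measure M
  for M :: "'a measure" +
  fixes \<sigma> :: "'a \<Rightarrow> 'a \<Rightarrow> real" and b \<gamma> \<alpha> :: real
  assumes kernel_measurable: "(\<lambda>(x, y). \<sigma> x y) \<in> borel_measurable (M \<Otimes>\<^sub>M M)"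
    and kernel_nonneg: "0 \<le> \<sigma> x y"
    and b_pos: "b > 0" and \<alpha>_pos: "0 < \<alpha>" and \<alpha>_less: "\<alpha> < \<gamma>"
    and growth_right: "r > 0 \<Longrightarrow> (\<integral>\<^sup>+y. indicator {y. \<sigma> x y < r} y \<partial>M) \<le> ennreal (b * r powr \<gamma>)"
    and growth_left: "r > 0 \<Longrightarrow> (\<integral>\<^sup>+x. indicator {x. \<sigma> x y < r} x \<partial>M) \<le> ennreal (b * r powr \<gamma>)"
begin

lemma kernel_measurable' [measurable (raw)]:
  assumes "g \<in> measurable N M" "h \<in> measurable N M"
  shows "(\<lambda>w. \<sigma> (g w) (h w)) \<in> borel_measurable N"
  using measurable_compose[OF measurable_Pair[OF assms] kernel_measurable] by simp

text \<open>The one piece of the potential without a pointwise bound; only its integral over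
  \<open>x\<close> is estimated.\<close>

definition truncated :: "('a \<Rightarrow> real) \<Rightarrow> real \<Rightarrow> real \<Rightarrow> 'a \<Rightarrow> ennreal" where
  "truncated f h \<delta> x = (\<integral>\<^sup>+y. ennreal (f y) * indicator {y. h < f y} y *
     (ennreal (\<sigma> x y powr - (\<gamma> - \<alpha>)) * indicator {y. \<sigma> x y < \<delta>} y) \<partial>M)"

text \<open>Split at \<open>\<sigma> x y = \<delta>\<close> and at \<open>f y = h\<close>. The far
  part is a radial tail for the mass of \<open>f\<close>, the near part with
  \<open>f y \<le> h\<close> is dominated by a radial head for the constant \<open>h\<close>, and
  the rest is \<open>truncated\<close>.\<close>

lemma potential_le_truncated:
  assumes [measurable]: "f \<in> borel_measurable M" and x: "x \<in> space M"
    and \<beta>: "\<beta> > 0" and A: "A \<ge> 0" and \<delta>: "\<delta> > 0" and h: "h \<ge> 0"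
    and mass: "\<And>r. r > 0 \<Longrightarrow> (\<integral>\<^sup>+y. ennreal (f y) * indicator {y. \<sigma> x y < r} y \<partial>M) \<le> ennreal (A * r powr (\<gamma> - \<alpha> - \<beta>))"
  shows "(\<integral>\<^sup>+y. ennreal (f y) * ennreal (\<sigma> x y powr - (\<gamma> - \<alpha>)) \<partial>M)
    \<le> ennreal (A * ((\<gamma> - \<alpha>) / \<beta>) * \<delta> powr - \<beta>) + ennreal (h * (b * (\<gamma> / \<alpha>) * \<delta> powr \<alpha>)) + truncated f h \<delta> x"
proof -
  have sf: "sigma_finite_measure M" by unfold_locales
  have [measurable]: "\<sigma> x \<in> borel_measurable M" using x by measurable
  let ?k = "\<lambda>y. ennreal (\<sigma> x y powr - (\<gamma> - \<alpha>))"
  have m: "0 < \<gamma> - \<alpha>" using \<alpha>_less by simp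
  have "(\<integral>\<^sup>+y. ennreal (f y) * ?k y \<partial>M)
     \<le> (\<integral>\<^sup>+y. ennreal (f y) * ?k y * indicator {y. \<delta> \<le> \<sigma> x y} y
          + ennreal h * (1 * ?k y * indicator {y. \<sigma> x y < \<delta>} y)
          + ennreal (f y) * indicator {y. h < f y} y * (?k y * indicator {y. \<sigma> x y < \<delta>} y) \<partial>M)"
    by (intro nn_integral_mono) (auto simp: indicator_def not_less intro!: mult_right_mono ennreal_leI)
  also have "\<dots> = (\<integral>\<^sup>+y. ennreal (f y) * ?k y * indicator {y. \<delta> \<le> \<sigma> x y} y \<partial>M)
          + ennreal h * (\<integral>\<^sup>+y. 1 * ?k y * indicator {y. \<sigma> x y < \<delta>} y \<partial>M) + truncated f h \<delta> x"
    unfolding truncated_def by (subst nn_integral_add nn_integral_cmult; simp)+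
  \<comment> \<open>\<beta> is the gap between the kernel exponent and the mass exponent of
    \<open>f\<close>, and \<alpha> the gap between \<gamma> and the kernel exponent; unsimplified,
    the exponents match the two radial lemmas.\<close>
  also have "\<dots> \<le> ennreal (A * ((\<gamma> - \<alpha>) / ((\<gamma> - \<alpha>) - (\<gamma> - \<alpha> - \<beta>))) * \<delta> powr ((\<gamma> - \<alpha> - \<beta>) - (\<gamma> - \<alpha>)))
          + ennreal h * ennreal (b * (\<gamma> / (\<gamma> - (\<gamma> - \<alpha>))) * \<delta> powr (\<gamma> - (\<gamma> - \<alpha>))) + truncated f h \<delta> x"
    using \<beta> \<delta> m A b_pos \<alpha>_pos mass growth_right[of _ x] kernel_nonneg
    by (intro add_mono mult_left_mono nn_integral_radial_tail[OF sf] nn_integral_radial_head[OF sf]) auto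
  finally show ?thesis using h b_pos \<alpha>_pos \<alpha>_less by (simp flip: ennreal_mult)
qed

text \<open>After Tonelli the inner integral over \<open>x\<close> is a radial head, bounded
  independently of \<open>y\<close>. The set \<open>B'\<close> contains the points within \<delta>
  of \<open>B\<close>, so only the values of \<open>f\<close> on it count.\<close>

lemma truncated_integral_le:
  assumes [measurable]: "f \<in> borel_measurable M" "B \<in> sets M" "B' \<in> sets M"
    and \<delta>: "\<delta> > 0" and sub: "\<And>x y. x \<in> B \<Longrightarrow> y \<in> space M \<Longrightarrow> \<sigma> x y < \<delta> \<Longrightarrow> y \<in> B'"
  shows "(\<integral>\<^sup>+x\<in>B. truncated f h \<delta> x \<partial>M)
    \<le> ennreal (b * (\<gamma> / \<alpha>) * \<delta> powr \<alpha>) * (\<integral>\<^sup>+y\<in>B'. ennreal (f y) * indicator {y. h < f y} y \<partial>M)"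
proof -
  interpret pair_sigma_finite M M by unfold_locales
  have sf: "sigma_finite_measure M" by unfold_locales
  let ?k = "\<lambda>x y. ennreal (\<sigma> x y powr - (\<gamma> - \<alpha>))"
  let ?F = "\<lambda>y. ennreal (f y) * indicator {y. h < f y} y"
  have "(\<integral>\<^sup>+x\<in>B. truncated f h \<delta> x \<partial>M)
    = (\<integral>\<^sup>+x. \<integral>\<^sup>+y. ?F y * (?k x y * indicator {y. \<sigma> x y < \<delta>} y) * indicator B x \<partial>M \<partial>M)"
    unfolding truncated_def by (intro nn_integral_cong, subst nn_integral_multc) auto
  also have "\<dots> = (\<integral>\<^sup>+y. \<integral>\<^sup>+x. ?F y * (?k x y * indicator {y. \<sigma> x y < \<delta>} y) * indicator B x \<partial>M \<partial>M)"
    by (subst Fubini') (auto simp: indicator_def)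
  also have "\<dots> \<le> (\<integral>\<^sup>+y. ennreal (b * (\<gamma> / \<alpha>) * \<delta> powr \<alpha>) * (?F y * indicator B' y) \<partial>M)"
  proof (intro nn_integral_mono)
    fix y assume y: "y \<in> space M"
    have [measurable]: "(\<lambda>x. \<sigma> x y) \<in> borel_measurable M" using y by measurable
    have "(\<integral>\<^sup>+x. ?F y * (?k x y * indicator {y. \<sigma> x y < \<delta>} y) * indicator B x \<partial>M)
      \<le> (\<integral>\<^sup>+x. ?F y * indicator B' y * (1 * ?k x y * indicator {x. \<sigma> x y < \<delta>} x) \<partial>M)"
      using sub[OF _ y] by (intro nn_integral_mono) (auto simp: indicator_def)
    also have "\<dots> = ?F y * indicator B' y * (\<integral>\<^sup>+x. 1 * ?k x y * indicator {x. \<sigma> x y < \<delta>} x \<partial>M)"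
      by (subst nn_integral_cmult) auto
    also have "\<dots> \<le> ?F y * indicator B' y * ennreal (b * (\<gamma> / (\<gamma> - (\<gamma> - \<alpha>))) * \<delta> powr (\<gamma> - (\<gamma> - \<alpha>)))"
      using \<delta> b_pos \<alpha>_pos \<alpha>_less growth_left[of _ y] kernel_nonneg
      by (intro mult_left_mono nn_integral_radial_head[OF sf]) auto
    finally show "(\<integral>\<^sup>+x. ?F y * (?k x y * indicator {y. \<sigma> x y < \<delta>} y) * indicator B x \<partial>M)
       \<le> ennreal (b * (\<gamma> / \<alpha>) * \<delta> powr \<alpha>) * (?F y * indicator B' y)" by (simp add: ac_simps)
  qed
  also have "\<dots> = ennreal (b * (\<gamma> / \<alpha>) * \<delta> powr \<alpha>) * (\<integral>\<^sup>+y\<in>B'. ?F y \<partial>M)"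
    by (subst nn_integral_cmult) auto
  finally show ?thesis .
qed

text \<open>The first term pays for the levels below \<open>P * r powr - \<beta>\<close>, where the
  splitting radius would exceed \<open>r\<close>. At higher levels the near part only sees
  \<open>B'\<close>, and integrating the level estimates gives the second term. Its factor
  \<open>s / (s - 1)\<close> is the reason for keeping \<open>s\<close> away from 1.\<close>

lemma strong_type:
  fixes s t \<beta> A r :: real and f u :: "'a \<Rightarrow> real"
  defines "P \<equiv> 4 * A * ((\<gamma> - \<alpha>) / \<beta>)" and "Q \<equiv> 4 * b * (\<gamma> / \<alpha>)"
  assumes f [measurable]: "f \<in> borel_measurable M" and f_nonneg: "\<And>y. 0 \<le> f y"
    and B [measurable]: "B \<in> sets M" "B' \<in> sets M"
    and st: "1 < s" "s < t" and \<beta>: "\<beta> > 0" and eq: "\<alpha> / \<beta> = t / s - 1" and A: "A > 0" and r: "r > 0"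
    and mass: "\<And>x r. r > 0 \<Longrightarrow> (\<integral>\<^sup>+y. ennreal (f y) * indicator {y. \<sigma> x y < r} y \<partial>M) \<le> ennreal (A * r powr (\<gamma> - \<alpha> - \<beta>))"
    and sub: "\<And>x y. x \<in> B \<Longrightarrow> y \<in> space M \<Longrightarrow> \<sigma> x y < r \<Longrightarrow> y \<in> B'"
    and u: "\<And>x. x \<in> B \<Longrightarrow> 0 \<le> u x"
      "\<And>x. x \<in> B \<Longrightarrow> ennreal (u x) \<le> (\<integral>\<^sup>+y. ennreal (f y) * ennreal (\<sigma> x y powr - (\<gamma> - \<alpha>)) \<partial>M)"
  shows "(\<integral>\<^sup>+x\<in>B. ennreal (u x powr t) \<partial>M)
    \<le> ennreal ((P * r powr - \<beta>) powr t) * emeasure M B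
      + ennreal (s / (2 * (s - 1)) * Q powr s * P powr (t - s)) * (\<integral>\<^sup>+y\<in>B'. ennreal (f y powr s) \<partial>M)"
proof -
  interpret L: pair_sigma_finite M lborel
    by (simp add: pair_sigma_finite_def sigma_finite_lborel sigma_finite_measure_axioms)
  define k where "k = \<alpha> / \<beta>"
  define e where "e = t - t / s"
  \<comment> \<open>\<open>P\<close> and \<open>Q\<close> are four times the constants of the far
    part and of the near part below \<open>h\<close>. So \<open>\<delta> \<tau>\<close> solves
    \<open>P * \<delta> powr - \<beta> = \<tau>\<close> and \<open>h \<tau>\<close> solves
    \<open>Q * h * \<delta> powr \<alpha> = \<tau>\<close>, which makes each part
    \<open>\<tau> / 4\<close>; \<open>T\<close> is the level at which \<open>\<delta> \<tau>\<close>
    equals \<open>r\<close>.\<close>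
  define \<delta> where "\<delta> \<tau> = (P / \<tau>) powr (1 / \<beta>)" for \<tau>
  define h where "h \<tau> = \<tau> / (Q * (P / \<tau>) powr k)" for \<tau>
  define T where "T = P * r powr - \<beta>"
  \<comment> \<open>For \<open>\<tau> > 0\<close>, \<open>h \<tau> < f y\<close> is equivalent to \<open>\<tau> < c y\<close>.\<close>
  define c where "c y = (Q * P powr k * f y) powr (s / t)" for y
  have [measurable]: "\<delta> \<in> borel_measurable borel" "h \<in> borel_measurable borel"
    unfolding \<delta>_def h_def by measurable
  have P: "P > 0" and Q: "Q > 0" using A \<beta> \<alpha>_pos \<alpha>_less b_pos by (auto simp: P_def Q_def)
  have T: "T > 0" using P r by (simp add: T_def)
  have k: "1 + k = t / s" using eq by (simp add: k_def)
  have e: "e > 0" "t - 1 - k = e" using st k by (auto simp: e_def field_simps)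

  have \<delta>_powr: "\<delta> \<tau> powr \<alpha> = (P / \<tau>) powr k" "\<delta> \<tau> powr - \<beta> = \<tau> / P" if "\<tau> > 0" for \<tau>
    using that P \<beta> by (simp_all add: \<delta>_def k_def powr_powr powr_minus divide_simps)
  have \<delta>_pos: "\<delta> \<tau> > 0" if "\<tau> > 0" for \<tau> using that P by (simp add: \<delta>_def)
  have \<delta>_le: "\<delta> \<tau> \<le> r" if "\<tau> \<ge> T" for \<tau>
  proof -
    have "P / \<tau> \<le> P / T" using that T P by (intro divide_left_mono) auto
    also have "\<dots> = r powr \<beta>" using P by (simp add: T_def powr_minus_divide)
    finally have "\<delta> \<tau> \<le> (r powr \<beta>) powr (1 / \<beta>)" using that T P \<beta> unfolding \<delta>_def by (intro powr_mono2) auto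
    then show ?thesis using \<beta> r by (simp add: powr_powr)
  qed

  have level: "ennreal (\<tau> / 2) \<le> truncated f (h \<tau>) (\<delta> \<tau>) x" if x: "x \<in> B" and \<tau>: "0 < \<tau>" "\<tau> < u x" for x \<tau>
  proof -
    have xM: "x \<in> space M" using x B sets.sets_into_space by blast
    have h: "h \<tau> \<ge> 0" using \<tau> Q by (simp add: h_def)
    have 1: "A * ((\<gamma> - \<alpha>) / \<beta>) * \<delta> \<tau> powr - \<beta> = \<tau> / 4"
    proof -
      have P4: "A * ((\<gamma> - \<alpha>) / \<beta>) = P / 4" by (simp add: P_def)
      show ?thesis unfolding P4 \<delta>_powr[OF \<tau>(1)] using P by simp
    qed
    have 2: "h \<tau> * (b * (\<gamma> / \<alpha>) * \<delta> \<tau> powr \<alpha>) = \<tau> / 4"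
    proof -
      have Q4: "b * (\<gamma> / \<alpha>) = Q / 4" by (simp add: Q_def)
      show ?thesis unfolding Q4 \<delta>_powr[OF \<tau>(1)] using Q P \<tau> by (simp add: h_def)
    qed
    have "ennreal \<tau> \<le> ennreal (u x)" using \<tau> by (intro ennreal_leI) simp
    also have "\<dots> \<le> ennreal (\<tau> / 4) + ennreal (\<tau> / 4) + truncated f (h \<tau>) (\<delta> \<tau>) x"
      by (rule order_trans[OF u(2)[OF x] potential_le_truncated[OF f xM \<beta> less_imp_le[OF A] \<delta>_pos[OF \<tau>(1)] h mass, unfolded 1 2]])
    also have "ennreal (\<tau> / 4) + ennreal (\<tau> / 4) = ennreal (\<tau> / 2)" using \<tau> by (simp flip: ennreal_plus)
    finally have "ennreal (\<tau> / 2) + ennreal (\<tau> / 2) \<le> ennreal (\<tau> / 2) + truncated f (h \<tau>) (\<delta> \<tau>) x"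
      using \<tau> by (simp flip: ennreal_plus)
    then show ?thesis by (simp add: ennreal_add_left_cancel_le)
  qed

  \<comment> \<open>For \<tau> below \<open>u x\<close>, \<open>level\<close> bounds
    \<open>\<tau> / 2\<close> by the truncated part, so the layer-cake weight
    \<open>t * \<tau> powr (t - 1)\<close> is traded for \<open>2 * t * \<tau> powr (t - 2)\<close>
    times that part.\<close>
  define G where "G \<tau> x = ennreal (2 * t * \<tau> powr (t - 2)) * indicator {T..} \<tau> * truncated f (h \<tau>) (\<delta> \<tau>) x" for \<tau> x
  have G_meas: "(\<lambda>(x, \<tau>). G \<tau> x) \<in> borel_measurable (M \<Otimes>\<^sub>M lborel)"
    unfolding G_def truncated_def by (simp add: indicator_def)
  \<comment> \<open>The layer-cake formula is used at each point \<open>x\<close> and gives a bound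
    by a measurable function of \<open>x\<close>, which covers a non-measurable
    \<open>u\<close>.\<close>
  have layer: "ennreal (u x powr t) \<le> ennreal (T powr t) + (\<integral>\<^sup>+\<tau>. G \<tau> x \<partial>lborel)" if x: "x \<in> B" for x
  proof -
    have xM [measurable]: "x \<in> space M" using x B sets.sets_into_space by blast
    have [measurable]: "(\<lambda>\<tau>. G \<tau> x) \<in> borel_measurable lborel"
      using measurable_compose[OF measurable_Pair1'[OF xM] G_meas] by simp
    have "ennreal (u x powr t) = (\<integral>\<^sup>+\<tau>. ennreal (t * \<tau> powr (t - 1)) * indicator {0<..<u x} \<tau> \<partial>lborel)"
      using nn_integral_powr_head[of t "u x"] st u(1)[OF x] by simp
    also have "\<dots> \<le> (\<integral>\<^sup>+\<tau>. ennreal (t * \<tau> powr (t - 1)) * indicator {0<..<T} \<tau> + G \<tau> x \<partial>lborel)"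
    proof (intro nn_integral_mono)
      fix \<tau> :: real
      consider "\<tau> \<le> 0 \<or> u x \<le> \<tau>" | "0 < \<tau>" "\<tau> < T" | "0 < \<tau>" "\<tau> < u x" "T \<le> \<tau>" by linarith
      then show "ennreal (t * \<tau> powr (t - 1)) * indicator {0<..<u x} \<tau>
        \<le> ennreal (t * \<tau> powr (t - 1)) * indicator {0<..<T} \<tau> + G \<tau> x"
      proof cases
        case 3
        have "\<tau> powr (t - 2) * \<tau> = \<tau> powr (t - 1)"
          using 3 by (simp add: powr_mult_base mult.commute)
        then have "ennreal (t * \<tau> powr (t - 1)) = ennreal (2 * t * \<tau> powr (t - 2)) * ennreal (\<tau> / 2)"
          using st 3 by (simp flip: ennreal_mult)
        also have "\<dots> \<le> G \<tau> x"
          using 3 level[OF x 3(1,2)] by (auto simp: G_def intro!: mult_left_mono)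
        finally show ?thesis using 3 by simp
      qed (auto simp: indicator_def)
    qed
    also have "\<dots> = ennreal (T powr t) + (\<integral>\<^sup>+\<tau>. G \<tau> x \<partial>lborel)"
      using nn_integral_powr_head[of t T] st T by (subst nn_integral_add) auto
    finally show ?thesis .
  qed

  have "(\<integral>\<^sup>+x. (\<integral>\<^sup>+\<tau>. G \<tau> x \<partial>lborel) * indicator B x \<partial>M) = (\<integral>\<^sup>+x. \<integral>\<^sup>+\<tau>. G \<tau> x * indicator B x \<partial>lborel \<partial>M)"
    using G_meas by (intro nn_integral_cong, subst nn_integral_multc) auto
  also have "\<dots> = (\<integral>\<^sup>+\<tau>. \<integral>\<^sup>+x. G \<tau> x * indicator B x \<partial>M \<partial>lborel)"
    using G_meas by (subst L.Fubini') auto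
  also have "\<dots> \<le> (\<integral>\<^sup>+\<tau>. \<integral>\<^sup>+y. ennreal (Q / 2 * (t / e) * P powr k * f y) * indicator B' y *
       (ennreal (e * \<tau> powr (e - 1)) * indicator {0<..<c y} \<tau>) \<partial>M \<partial>lborel)"
  proof (rule nn_integral_mono)
    fix \<tau> :: real
    show "(\<integral>\<^sup>+x\<in>B. G \<tau> x \<partial>M) \<le> (\<integral>\<^sup>+y. ennreal (Q / 2 * (t / e) * P powr k * f y) * indicator B' y *
       (ennreal (e * \<tau> powr (e - 1)) * indicator {0<..<c y} \<tau>) \<partial>M)"
    proof (cases "T \<le> \<tau>")
      case False
      then show ?thesis by (simp add: G_def)
    next
      case True
      then have \<tau>: "\<tau> > 0" using T by simp
      let ?m = "2 * t * \<tau> powr (t - 2)"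
      have tr [measurable]: "truncated f (h \<tau>) (\<delta> \<tau>) \<in> borel_measurable M" unfolding truncated_def by (simp add: indicator_def)
      have "(\<integral>\<^sup>+x\<in>B. G \<tau> x \<partial>M) = ennreal ?m * (\<integral>\<^sup>+x\<in>B. truncated f (h \<tau>) (\<delta> \<tau>) x \<partial>M)"
        using True by (subst nn_integral_cmult[symmetric]) (auto simp: G_def mult.assoc)
      \<comment> \<open>\<open>T \<le> \<tau>\<close> gives \<open>\<delta> \<tau> \<le> r\<close>,
        so \<open>sub\<close> keeps the integration over \<open>y\<close> inside
        \<open>B'\<close>.\<close>
      also have "\<dots> \<le> ennreal ?m * (ennreal (b * (\<gamma> / \<alpha>) * \<delta> \<tau> powr \<alpha>) *
          (\<integral>\<^sup>+y\<in>B'. ennreal (f y) * indicator {y. h \<tau> < f y} y \<partial>M))"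
        using sub \<delta>_le[OF True] by (intro mult_left_mono truncated_integral_le \<delta>_pos \<tau>) (auto intro: less_le_trans)
      also have "\<dots> = (ennreal ?m * ennreal (Q / 4 * (P / \<tau>) powr k)) *
          (\<integral>\<^sup>+y\<in>B'. ennreal (f y) * indicator {y. h \<tau> < f y} y \<partial>M)"
        unfolding \<delta>_powr[OF \<tau>] by (simp add: Q_def mult.assoc)
      also have "ennreal ?m * ennreal (Q / 4 * (P / \<tau>) powr k) = ennreal (Q / 2 * (t / e) * P powr k * (e * \<tau> powr (e - 1)))"
      proof -
        have "\<tau> powr (t - 2) / \<tau> powr k = \<tau> powr (e - 1)"
          by (simp flip: powr_diff e(2) add: algebra_simps)
        then have "?m * (Q / 4 * (P / \<tau>) powr k) = Q / 2 * (t / e) * P powr k * (e * \<tau> powr (e - 1))"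
          using e(1) P \<tau> by (simp add: powr_divide field_simps)
        then show ?thesis using st Q P by (simp flip: ennreal_mult)
      qed
      also have "ennreal (Q / 2 * (t / e) * P powr k * (e * \<tau> powr (e - 1))) *
          (\<integral>\<^sup>+y\<in>B'. ennreal (f y) * indicator {y. h \<tau> < f y} y \<partial>M)
        = (\<integral>\<^sup>+y. ennreal (Q / 2 * (t / e) * P powr k * (e * \<tau> powr (e - 1))) * (ennreal (f y) * indicator {y. h \<tau> < f y} y * indicator B' y) \<partial>M)"
        by (subst nn_integral_cmult) auto
      also have "\<dots> \<le> (\<integral>\<^sup>+y. ennreal (Q / 2 * (t / e) * P powr k * f y) * indicator B' y *
       (ennreal (e * \<tau> powr (e - 1)) * indicator {0<..<c y} \<tau>) \<partial>M)"
      proof (intro nn_integral_mono)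
        fix y
        have "\<tau> < c y" if "h \<tau> < f y"
        proof -
          have "\<tau> < f y * (Q * (P / \<tau>) powr k)" using that \<tau> P Q by (simp add: h_def pos_divide_less_eq)
          then have "\<tau> * \<tau> powr k < Q * P powr k * f y"
            using \<tau> P by (simp add: powr_divide field_simps)
          then have "\<tau> powr (t / s) < Q * P powr k * f y"
            using \<tau> by (simp flip: k(1) add: powr_add)
          then have "(\<tau> powr (t / s)) powr (s / t) < c y"
            unfolding c_def using st by (intro powr_less_mono2) auto
          then show ?thesis using \<tau> st by (simp add: powr_powr)
        qed
        then show "ennreal (Q / 2 * (t / e) * P powr k * (e * \<tau> powr (e - 1))) * (ennreal (f y) * indicator {y. h \<tau> < f y} y * indicator B' y)
          \<le> ennreal (Q / 2 * (t / e) * P powr k * f y) * indicator B' y * (ennreal (e * \<tau> powr (e - 1)) * indicator {0<..<c y} \<tau>)"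
          using \<tau> Q st e P f_nonneg[of y] by (auto simp: indicator_def ac_simps simp flip: ennreal_mult)
      qed
      finally show ?thesis .
    qed
  qed
  also have "\<dots> = (\<integral>\<^sup>+y. \<integral>\<^sup>+\<tau>. ennreal (Q / 2 * (t / e) * P powr k * f y) * indicator B' y *
       (ennreal (e * \<tau> powr (e - 1)) * indicator {0<..<c y} \<tau>) \<partial>lborel \<partial>M)"
    unfolding c_def by (subst L.Fubini') (auto simp: indicator_def)
  also have "\<dots> = (\<integral>\<^sup>+y. ennreal (s / (2 * (s - 1)) * Q powr s * P powr (t - s)) * (ennreal (f y powr s) * indicator B' y) \<partial>M)"
  proof (intro nn_integral_cong)
    fix y
    have "(\<integral>\<^sup>+\<tau>. ennreal (Q / 2 * (t / e) * P powr k * f y) * indicator B' y *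
       (ennreal (e * \<tau> powr (e - 1)) * indicator {0<..<c y} \<tau>) \<partial>lborel)
      = ennreal (Q / 2 * (t / e) * P powr k * f y) * indicator B' y * ennreal (c y powr e)"
      using nn_integral_powr_head[OF e(1), of "c y"] by (subst nn_integral_cmult) (auto simp: c_def)
    also have "\<dots> = ennreal (Q / 2 * (t / e) * P powr k * f y * c y powr e) * indicator B' y"
      using Q st e P f_nonneg[of y] by (simp add: ac_simps flip: ennreal_mult)
    \<comment> \<open>\<open>c y powr e\<close> is the power \<open>s - 1\<close> of
      \<open>Q * P powr k * f y\<close>, and one more such factor stands in front. Together they
      form its \<open>s\<close>-th power, and \<open>k * s = t - s\<close> gives the exponent of
      \<open>P\<close>.\<close>
    also have "Q / 2 * (t / e) * P powr k * f y * c y powr e = s / (2 * (s - 1)) * Q powr s * P powr (t - s) * f y powr s"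
    proof (cases "f y = 0")
      case False
      then have fy: "f y > 0" using f_nonneg[of y] by simp
      have "s / t * e = s - 1" using st by (simp add: e_def field_simps)
      then have "c y powr e = (Q * P powr k * f y) powr (s - 1)" by (simp add: c_def powr_powr)
      moreover have "t / e = s / (s - 1)" using st by (simp add: e_def field_simps)
      moreover have "(Q * P powr k * f y) powr (s - 1) * (Q * P powr k * f y) = (Q * P powr k * f y) powr s"
        using Q P fy by (simp add: powr_mult_base mult.commute)
      moreover have "(Q * P powr k * f y) powr s = Q powr s * P powr (t - s) * f y powr s"
      proof -
        have "k * s = t - s" using k(1) st by (simp add: field_simps)
        then show ?thesis using Q P fy by (simp add: powr_mult powr_powr)
      qed
      ultimately show ?thesis by (simp add: field_simps)
    qed (use st in simp)
    also have "ennreal (s / (2 * (s - 1)) * Q powr s * P powr (t - s) * f y powr s) * indicator B' y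
      = ennreal (s / (2 * (s - 1)) * Q powr s * P powr (t - s)) * (ennreal (f y powr s) * indicator B' y)"
      using Q st P by (subst ennreal_mult) (auto simp: mult.assoc)
    finally show "(\<integral>\<^sup>+\<tau>. ennreal (Q / 2 * (t / e) * P powr k * f y) * indicator B' y *
       (ennreal (e * \<tau> powr (e - 1)) * indicator {0<..<c y} \<tau>) \<partial>lborel)
      = ennreal (s / (2 * (s - 1)) * Q powr s * P powr (t - s)) * (ennreal (f y powr s) * indicator B' y)" .
  qed
  also have "\<dots> = ennreal (s / (2 * (s - 1)) * Q powr s * P powr (t - s)) * (\<integral>\<^sup>+y\<in>B'. ennreal (f y powr s) \<partial>M)"
    by (subst nn_integral_cmult) auto
  finally have main: "(\<integral>\<^sup>+x. (\<integral>\<^sup>+\<tau>. G \<tau> x \<partial>lborel) * indicator B x \<partial>M)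
     \<le> ennreal (s / (2 * (s - 1)) * Q powr s * P powr (t - s)) * (\<integral>\<^sup>+y\<in>B'. ennreal (f y powr s) \<partial>M)" .

  have "(\<integral>\<^sup>+x\<in>B. ennreal (u x powr t) \<partial>M)
    \<le> (\<integral>\<^sup>+x. ennreal (T powr t) * indicator B x + (\<integral>\<^sup>+\<tau>. G \<tau> x \<partial>lborel) * indicator B x \<partial>M)"
    using layer by (intro nn_integral_mono) (auto simp: indicator_def)
  also have "\<dots> = ennreal (T powr t) * emeasure M B + (\<integral>\<^sup>+x. (\<integral>\<^sup>+\<tau>. G \<tau> x \<partial>lborel) * indicator B x \<partial>M)"
    using G_meas by (subst nn_integral_add) (auto simp: nn_integral_cmult_indicator)
  also note add_left_mono[OF main]
  finally show ?thesis by (simp add: T_def)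
qed

end

section \<open>Potentials on Morrey spaces\<close>

text \<open>For \<open>A = N powr s\<close> this bounds the Morrey norm of exponent \<open>s\<close>
  by \<open>N\<close>; leaving out the root avoids powers of infinite values.\<close>

definition morrey_bound ::
  "'a measure \<Rightarrow> ('a \<Rightarrow> 'a \<Rightarrow> real) \<Rightarrow> real \<Rightarrow> real \<Rightarrow> real \<Rightarrow> ('a \<Rightarrow> real) \<Rightarrow> bool" where
  "morrey_bound M \<rho> s \<kappa> A f \<longleftrightarrow> (\<forall>x r. 0 < r \<longrightarrow> r < qdiam \<rho> \<longrightarrow>
     (\<integral>\<^sup>+y\<in>qball \<rho> x r. ennreal (\<bar>f y\<bar> powr s) \<partial>M) \<le> ennreal (A * r powr \<kappa>))"

text \<open>Split at \<delta> = 1 and \<open>h = 0\<close>: the far part is bounded, and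
  \<open>truncated f 0 1\<close> has finite integral, hence is finite almost everywhere.\<close>

lemma (in fractional_kernel) AE_kernel_potential_finite:
  assumes f [measurable]: "f \<in> borel_measurable M" and fin: "(\<integral>\<^sup>+y. ennreal (f y) \<partial>M) < \<infinity>"
    and \<beta>: "\<beta> > 0" and A: "A \<ge> 0"
    and mass: "\<And>x r. r > 0 \<Longrightarrow> (\<integral>\<^sup>+y. ennreal (f y) * indicator {y. \<sigma> x y < r} y \<partial>M) \<le> ennreal (A * r powr (\<gamma> - \<alpha> - \<beta>))"
  shows "AE x in M. (\<integral>\<^sup>+y. ennreal (f y) * ennreal (\<sigma> x y powr - (\<gamma> - \<alpha>)) \<partial>M) < \<infinity>"
proof -
  have [measurable]: "truncated f 0 1 \<in> borel_measurable M" unfolding truncated_def by (simp add: indicator_def)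
  have "(\<integral>\<^sup>+x. truncated f 0 1 x \<partial>M) = (\<integral>\<^sup>+x\<in>space M. truncated f 0 1 x \<partial>M)"
    by (intro nn_integral_cong) simp
  also have "\<dots> \<le> ennreal (b * (\<gamma> / \<alpha>) * 1 powr \<alpha>) * (\<integral>\<^sup>+y\<in>space M. ennreal (f y) * indicator {y. 0 < f y} y \<partial>M)"
    by (rule truncated_integral_le) auto
  also have "\<dots> \<le> ennreal (b * (\<gamma> / \<alpha>) * 1 powr \<alpha>) * (\<integral>\<^sup>+y. ennreal (f y) \<partial>M)"
    by (intro mult_left_mono nn_integral_mono) (auto simp: indicator_def)
  also have "\<dots> < \<infinity>" using fin by (simp add: ennreal_mult_less_top)
  finally have "AE x in M. truncated f 0 1 x \<noteq> \<infinity>"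
    by (intro nn_integral_PInf_AE) auto
  then show ?thesis
  proof (rule AE_mp, intro AE_I2 impI)
    fix x assume x: "x \<in> space M" "truncated f 0 1 x \<noteq> \<infinity>"
    have "(\<integral>\<^sup>+y. ennreal (f y) * ennreal (\<sigma> x y powr - (\<gamma> - \<alpha>)) \<partial>M)
      \<le> ennreal (A * ((\<gamma> - \<alpha>) / \<beta>) * 1 powr - \<beta>) + ennreal (0 * (b * (\<gamma> / \<alpha>) * 1 powr \<alpha>)) + truncated f 0 1 x"
      by (rule potential_le_truncated[OF f x(1) \<beta> A _ _ mass]) auto
    also have "\<dots> < \<infinity>" using x(2) by (simp add: less_top)
    finally show "(\<integral>\<^sup>+y. ennreal (f y) * ennreal (\<sigma> x y powr - (\<gamma> - \<alpha>)) \<partial>M) < \<infinity>" .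
  qed
qed

text \<open>Compare \<open>z\<close> with the threshold \<open>a\<close>. This stands in for
  Hoelder's inequality, with \<open>a\<close> chosen later to balance the two terms.\<close>

lemma powr_le_interpolate:
  fixes z a :: real
  assumes "0 \<le> z" "0 < a" "0 \<le> t" "t \<le> s"
  shows "z powr t \<le> a powr (t - s) * z powr s + a powr t"
proof (cases "z \<le> a")
  case True
  then have "z powr t \<le> a powr t" using assms by (intro powr_mono2) auto
  then show ?thesis by (simp add: add_increasing)
next
  case False
  then have "z powr t = z powr (t - s) * z powr s" by (simp flip: powr_add)
  also have "\<dots> \<le> a powr (t - s) * z powr s"
    using False assms by (intro mult_right_mono powr_mono2') auto
  finally show ?thesis by (simp add: add_increasing2)
qed

context homogeneous_space
begin

lemma mass_le_of_power_mass:
  assumes [measurable]: "f \<in> borel_measurable M" and s: "1 < s" and N: "N > 0" and r: "r > 0"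
    and c: "c \<ge> 0" and b: "b \<ge> 0"
    and pow: "(\<integral>\<^sup>+y\<in>qball \<rho> x r. ennreal (\<bar>f y\<bar> powr s) \<partial>M) \<le> ennreal (c * N powr s * r powr \<mu>)"
    and growth: "emeasure M (qball \<rho> x r) \<le> ennreal (b * r powr \<gamma>)"
  shows "(\<integral>\<^sup>+y\<in>qball \<rho> x r. ennreal \<bar>f y\<bar> \<partial>M) \<le> ennreal ((c + b) * N * r powr (\<gamma> - (\<gamma> - \<mu>) / s))"
proof -
  have [measurable]: "qball \<rho> x r \<in> sets M" using r by (rule qball_sets)
  \<comment> \<open>This threshold turns both terms of the interpolation into multiples of
    \<open>N * r powr (\<gamma> - (\<gamma> - \<mu>) / s)\<close>.\<close>
  define a where "a = N * r powr (- (\<gamma> - \<mu>) / s)"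
  have a: "a > 0" using N r by (simp add: a_def)
  have "\<bar>f y\<bar> \<le> a powr (1 - s) * \<bar>f y\<bar> powr s + a" for y
    using powr_le_interpolate[of "\<bar>f y\<bar>" a 1 s] a s by simp
  then have "(\<integral>\<^sup>+y\<in>qball \<rho> x r. ennreal \<bar>f y\<bar> \<partial>M)
    \<le> (\<integral>\<^sup>+y. ennreal (a powr (1 - s)) * (ennreal (\<bar>f y\<bar> powr s) * indicator (qball \<rho> x r) y) + ennreal a * indicator (qball \<rho> x r) y \<partial>M)"
    using a by (intro nn_integral_mono) (auto simp: indicator_def intro!: ennreal_leI simp flip: ennreal_mult ennreal_plus)
  also have "\<dots> = ennreal (a powr (1 - s)) * (\<integral>\<^sup>+y\<in>qball \<rho> x r. ennreal (\<bar>f y\<bar> powr s) \<partial>M) + ennreal a * emeasure M (qball \<rho> x r)"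
    by (simp add: nn_integral_add nn_integral_cmult nn_integral_cmult_indicator)
  also have "\<dots> \<le> ennreal (a powr (1 - s)) * ennreal (c * N powr s * r powr \<mu>) + ennreal a * ennreal (b * r powr \<gamma>)"
    using pow growth by (intro add_mono mult_left_mono) auto
  also have "\<dots> = ennreal (a powr (1 - s) * (c * N powr s * r powr \<mu>) + a * (b * r powr \<gamma>))"
    using a b c by (simp flip: ennreal_mult ennreal_plus)
  also have "a powr (1 - s) * (c * N powr s * r powr \<mu>) + a * (b * r powr \<gamma>) = (c + b) * N * r powr (\<gamma> - (\<gamma> - \<mu>) / s)"
  proof -
    have 1: "N powr (1 - s) * N powr s = N" using N by (simp flip: powr_add)
    have "- (\<gamma> - \<mu>) / s * (1 - s) + \<mu> = \<gamma> - (\<gamma> - \<mu>) / s" using s by (simp add: field_simps)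
    then have 2: "r powr (- (\<gamma> - \<mu>) / s * (1 - s)) * r powr \<mu> = r powr (\<gamma> - (\<gamma> - \<mu>) / s)"
      by (simp only: powr_add[symmetric])
    have 3: "r powr (- (\<gamma> - \<mu>) / s) * r powr \<gamma> = r powr (\<gamma> - (\<gamma> - \<mu>) / s)"
      by (simp flip: powr_add add: diff_divide_distrib algebra_simps)
    have "a powr (1 - s) = N powr (1 - s) * r powr (- (\<gamma> - \<mu>) / s * (1 - s))"
      using N r by (simp only: a_def powr_mult powr_powr)
    then have "a powr (1 - s) * (c * N powr s * r powr \<mu>)
      = c * (N powr (1 - s) * N powr s) * (r powr (- (\<gamma> - \<mu>) / s * (1 - s)) * r powr \<mu>)"
      by (simp only: ac_simps)
    moreover have "a * (b * r powr \<gamma>) = b * N * (r powr (- (\<gamma> - \<mu>) / s) * r powr \<gamma>)"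
      by (simp only: a_def ac_simps)
    ultimately show ?thesis unfolding 1 2 3 by (simp only: distrib_right)
  qed
  finally show ?thesis .
qed

text \<open>The point is the order of choices: \<open>C\<close> is fixed before \<open>s\<close>,
  \<open>t\<close>, \<open>f\<close> and \<open>N\<close>. The supremum over \<epsilon> in the grand
  norm requires this uniformity.\<close>

lemma potential_morrey_estimate:
  fixes b \<gamma> p q lam \<alpha> s\<^sub>0 :: real
  assumes b: "b > 0" and \<gamma>: "\<gamma> > 0"
    and growth: "\<And>x r. 0 < r \<Longrightarrow> r < qdiam \<rho> \<Longrightarrow> emeasure M (qball \<rho> x r) \<le> ennreal (b * r powr \<gamma>)"
    and lam: "0 \<le> lam" "lam < 1" and \<alpha>: "0 < \<alpha>" "\<alpha> < (1 - lam) * \<gamma> / p"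
    and q: "1 / p - 1 / q = \<alpha> / ((1 - lam) * \<gamma>)" and s0: "1 < s\<^sub>0" "s\<^sub>0 < p"
  obtains C where "C \<ge> 1"
    "\<And>s t f N. s\<^sub>0 \<le> s \<Longrightarrow> s < p \<Longrightarrow> 1 / s - 1 / t = \<alpha> / ((1 - lam) * \<gamma>) \<Longrightarrow> f \<in> borel_measurable M \<Longrightarrow> N > 0 \<Longrightarrow>
      morrey_bound M \<rho> s (\<gamma> * lam) (N powr s) f \<Longrightarrow>
      (AE x in M. integrable M (potential_integrand \<rho> \<gamma> \<alpha> f x)) \<and>
      morrey_bound M \<rho> t (\<gamma> * lam) (C * N powr t) (potential M \<rho> \<gamma> \<alpha> f)"
proof -
  obtain K where K: "K \<ge> 1" "\<And>x y z. \<rho> x y \<le> K * (\<rho> x z + \<rho> z y)" "\<And>x y. \<rho> x y \<le> K * \<rho> y x"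
    by (rule quasi_metric_const) blast
  obtain \<sigma> L where \<sigma>_meas: "(\<lambda>(x, y). \<sigma> x y) \<in> borel_measurable (M \<Otimes>\<^sub>M M)" and L: "L \<ge> 1"
    and \<sigma>: "\<And>x y. \<rho> x y \<le> \<sigma> x y" "\<And>x y. \<sigma> x y \<le> L * \<rho> x y"
    by (rule measurable_comparison) blast
  obtain c where c: "c \<ge> 1" and c_ext:
    "\<And>F A \<kappa> x r. F \<in> borel_measurable M \<Longrightarrow> A \<ge> 0 \<Longrightarrow> \<kappa> \<ge> 0 \<Longrightarrow>
       (\<And>x r. 0 < r \<Longrightarrow> r < qdiam \<rho> \<Longrightarrow> (\<integral>\<^sup>+y\<in>qball \<rho> x r. F y \<partial>M) \<le> ennreal (A * r powr \<kappa>)) \<Longrightarrow>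
       r > 0 \<Longrightarrow> (\<integral>\<^sup>+y\<in>qball \<rho> x r. F y \<partial>M) \<le> ennreal (c * A * r powr \<kappa>)"
    by (rule growth_all_radii) blast
  interpret M: finite_measure M by (rule finite_measure_M)
  define m where "m = \<gamma> - \<alpha>"
  \<comment> \<open>\<open>b1\<close> serves all radii; \<open>b2\<close> also pays for exchanging
    the arguments of \<rho>, which enlarges the radius by the factor \<open>K\<close>.\<close>
  define b1 where "b1 = c * b"
  define b2 where "b2 = b1 * K powr \<gamma>"
  have b1: "b1 > 0" using b c by (simp add: b1_def)
  have b2: "b1 \<le> b2" "b2 > 0" using b1 K(1) \<gamma> ge_one_powr_ge_zero[of K \<gamma>] by (simp_all add: b2_def)
  have ball_int: "(\<integral>\<^sup>+y. indicator (qball \<rho> x r) y \<partial>M) \<le> ennreal (b1 * r powr \<gamma>)" if "r > 0" for x r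
  proof -
    have "(\<integral>\<^sup>+y\<in>qball \<rho> x r. 1 \<partial>M) \<le> ennreal (c * b * r powr \<gamma>)"
      using b \<gamma> growth qball_sets that by (intro c_ext) auto
    then show ?thesis by (simp add: b1_def)
  qed
  have ball_le: "emeasure M (qball \<rho> x r) \<le> ennreal (b1 * r powr \<gamma>)" if "r > 0" for x r
    using ball_int[OF that, of x] qball_sets[OF that, of x] by simp
  have p: "p > 1" using s0 by simp
  have "\<alpha> < (1 - lam) * \<gamma>"
  proof -
    have "(1 - lam) * \<gamma> / p \<le> (1 - lam) * \<gamma> / 1" using p lam \<gamma> by (intro divide_left_mono) auto
    then show ?thesis using \<alpha> by simp
  qed
  moreover have "(1 - lam) * \<gamma> \<le> \<gamma>" using lam \<gamma> by (simp add: mult_left_le_one_le)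
  ultimately have \<alpha>\<gamma>: "\<alpha> < \<gamma>" by simp
  then have m: "m > 0" by (simp add: m_def)
  have \<sigma>_nonneg: "0 \<le> \<sigma> x y" for x y using \<sigma>(1)[of x y] rho_nonneg[of x y] by linarith
  interpret fractional_kernel M \<sigma> b2 \<gamma> \<alpha>
  proof
    fix r :: real and x assume r: "r > 0"
    have "(\<integral>\<^sup>+y. indicator {y. \<sigma> x y < r} y \<partial>M) \<le> (\<integral>\<^sup>+y. indicator (qball \<rho> x r) y \<partial>M)"
      using \<sigma>(1) by (intro nn_integral_mono) (auto simp: indicator_def qball_def intro: le_less_trans)
    also have "\<dots> \<le> ennreal (b1 * r powr \<gamma>)" by (rule ball_int[OF r])
    also have "\<dots> \<le> ennreal (b2 * r powr \<gamma>)" using b2 by (intro ennreal_leI mult_right_mono) auto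
    finally show "(\<integral>\<^sup>+y. indicator {y. \<sigma> x y < r} y \<partial>M) \<le> ennreal (b2 * r powr \<gamma>)" .
  next
    fix r :: real and y assume r: "r > 0"
    have "\<rho> y x < K * r" if "\<sigma> x y < r" for x
    proof -
      have "\<rho> y x \<le> K * \<rho> x y" by (rule K)
      also have "\<dots> < K * r" using \<sigma>(1)[of x y] that K(1) by (intro mult_strict_left_mono) auto
      finally show ?thesis .
    qed
    then have "(\<integral>\<^sup>+x. indicator {x. \<sigma> x y < r} x \<partial>M) \<le> (\<integral>\<^sup>+x. indicator (qball \<rho> y (K * r)) x \<partial>M)"
      by (intro nn_integral_mono) (auto simp: indicator_def qball_def)
    also have "\<dots> \<le> ennreal (b1 * (K * r) powr \<gamma>)" using K(1) r by (intro ball_int) auto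
    also have "b1 * (K * r) powr \<gamma> = b2 * r powr \<gamma>" using K(1) r by (simp add: b2_def powr_mult)
    finally show "(\<integral>\<^sup>+x. indicator {x. \<sigma> x y < r} x \<partial>M) \<le> ennreal (b2 * r powr \<gamma>)" .
  qed (use \<sigma>_meas \<sigma>_nonneg b2 \<alpha> \<alpha>\<gamma> in auto)

  define w where "w = (1 - lam) * \<gamma>"
  have w: "w > 0" "w \<le> \<gamma>" using lam \<gamma> by (auto simp: w_def mult_left_le_one_le)
  have q_pos: "q > 0"
  proof -
    have "\<alpha> / w < 1 / p" using \<alpha>(2) w p by (simp add: w_def field_simps)
    then have "1 / q > 0" using q unfolding w_def by linarith
    then show ?thesis by simp
  qed
  define A0 where "A0 = c + b1"
  \<comment> \<open>\<open>C0\<close> collects the constants of \<open>strong_type\<close>. Bases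
    with a varying exponent are made at least 1, so that the exponents can be raised to
    \<open>p\<close> or \<open>q\<close>, and \<open>s / (s - 1)\<close> is largest at
    \<open>s\<^sub>0\<close>.\<close>
  define P1 where "P1 = max 1 (4 * A0 * (m / (w / q)))"
  define Q where "Q = 4 * b2 * (\<gamma> / \<alpha>)"
  define Q1 where "Q1 = max 1 Q"
  define C0 where "C0 = P1 powr q * b1 + s\<^sub>0 / (2 * (s\<^sub>0 - 1)) * Q1 powr p * P1 powr q * (c * (2 * K) powr (\<gamma> * lam))"
  define C where "C = max 1 (L powr (m * q) * C0)"
  have C1: "C \<ge> 1" by (simp add: C_def)
  have A0: "A0 > 0" using c b1 by (simp add: A0_def)
  have Q: "Q > 0" "Q \<le> Q1" using b2 \<gamma> \<alpha> by (auto simp: Q_def Q1_def)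
  \<comment> \<open>On the diagonal the left side is 0 by the convention for division; elsewhere
    this is the upper comparison of \<sigma> with \<rho>.\<close>
  have kernel: "1 / \<rho> x y powr m \<le> L powr m * \<sigma> x y powr - m" for x y
  proof (cases "\<rho> x y = 0")
    case False
    then have pos: "\<rho> x y > 0" using rho_nonneg[of x y] by simp
    then have "\<sigma> x y > 0" using \<sigma>(1)[of x y] by simp
    moreover have "\<sigma> x y powr m \<le> (L * \<rho> x y) powr m"
      using \<sigma>(2)[of x y] \<sigma>_nonneg[of x y] m by (intro powr_mono2) auto
    ultimately show ?thesis using pos L
      by (simp add: powr_mult powr_minus field_simps)
  qed simp
  have "(AE x in M. integrable M (potential_integrand \<rho> \<gamma> \<alpha> f x)) \<and>
      morrey_bound M \<rho> t (\<gamma> * lam) (C * N powr t) (potential M \<rho> \<gamma> \<alpha> f)"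
    if s: "s\<^sub>0 \<le> s" "s < p" and t: "1 / s - 1 / t = \<alpha> / ((1 - lam) * \<gamma>)" and f [measurable]: "f \<in> borel_measurable M" and N: "N > 0"
      and morrey: "morrey_bound M \<rho> s (\<gamma> * lam) (N powr s) f"
    for s t f N
  proof -
    \<comment> \<open>This makes \<open>\<gamma> - \<alpha> - \<beta>\<close> equal to
      \<open>\<gamma> - w / s\<close>, the exponent that the Morrey condition gives for the mass on
      balls; by the exponent relation \<beta> is also \<open>w / t\<close>.\<close>
    define \<beta> where "\<beta> = w / s - \<alpha>"
    have s1: "s > 1" using s s0 by simp
    have t_inv: "1 / t = 1 / s - \<alpha> / w" using t by (simp add: w_def)
    have "1 / q = 1 / p - \<alpha> / w" using q by (simp add: w_def)
    moreover have "1 / p < 1 / s" using s s1 by (intro divide_strict_left_mono) auto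
    ultimately have tq: "1 / q < 1 / t" using t_inv by simp
    then have t_pos: "t > 0" using q_pos by (metis divide_pos_pos less_trans zero_less_divide_1_iff zero_less_one)
    have t_less: "t < q" using tq t_pos q_pos by (simp add: field_simps)
    have "1 / t < 1 / s" using t_inv \<alpha> w by simp
    then have st: "s < t" using t_pos s1 by (simp add: field_simps)
    have \<beta>_eq: "\<beta> = w / t"
    proof -
      have "w * (1 / t) = w * (1 / s - \<alpha> / w)" by (simp only: t_inv)
      then show ?thesis using w by (simp add: \<beta>_def right_diff_distrib)
    qed
    then have \<beta>: "\<beta> > 0" using w t_pos by simp
    have ratio: "\<alpha> / \<beta> = t / s - 1"
    proof -
      have "\<alpha> / w = 1 / s - 1 / t" using t by (simp add: w_def)
      then have "\<alpha> / w * t = t / s - 1" using t_pos by (simp add: left_diff_distrib)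
      then show ?thesis by (simp add: \<beta>_eq)
    qed
    \<comment> \<open>The factor lost in replacing \<rho> by \<sigma> is absorbed into the function,
      so \<open>strong_type\<close> is applied to \<open>F\<close> with kernel \<sigma>.\<close>
    define N' where "N' = L powr m * N"
    define F where "F y = L powr m * \<bar>f y\<bar>" for y
    have Lm: "L powr m > 0" using L by simp
    have N': "N' > 0" using N Lm by (simp add: N'_def)
    have F_nonneg: "0 \<le> F y" for y by (simp add: F_def)
    have F [measurable]: "F \<in> borel_measurable M" unfolding F_def by measurable
    have F_morrey: "(\<integral>\<^sup>+y\<in>qball \<rho> x r. ennreal (F y powr s) \<partial>M) \<le> ennreal (N' powr s * r powr (\<gamma> * lam))"
      if r: "0 < r" "r < qdiam \<rho>" for x r
    proof -
      note [measurable] = qball_sets[OF r(1), of x]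
      have "(\<integral>\<^sup>+y\<in>qball \<rho> x r. ennreal (F y powr s) \<partial>M)
        = (\<integral>\<^sup>+y. ennreal ((L powr m) powr s) * (ennreal (\<bar>f y\<bar> powr s) * indicator (qball \<rho> x r) y) \<partial>M)"
        using Lm by (intro nn_integral_cong) (simp add: F_def powr_mult ennreal_mult mult.assoc)
      also have "\<dots> = ennreal ((L powr m) powr s) * (\<integral>\<^sup>+y\<in>qball \<rho> x r. ennreal (\<bar>f y\<bar> powr s) \<partial>M)"
        by (rule nn_integral_cmult) measurable
      also have "\<dots> \<le> ennreal ((L powr m) powr s) * ennreal (N powr s * r powr (\<gamma> * lam))"
        using morrey r unfolding morrey_bound_def by (intro mult_left_mono) auto
      also have "\<dots> = ennreal (N' powr s * r powr (\<gamma> * lam))"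
        using Lm N by (simp add: N'_def powr_mult mult.assoc flip: ennreal_mult)
      finally show ?thesis .
    qed
    have power_mass: "(\<integral>\<^sup>+y\<in>qball \<rho> x r. ennreal (F y powr s) \<partial>M) \<le> ennreal (c * N' powr s * r powr (\<gamma> * lam))"
      if "r > 0" for x r
      using F_morrey that N' \<gamma> lam by (intro c_ext) auto
    define A where "A = A0 * N'"
    have A: "A > 0" using A0 N' by (simp add: A_def)
    have mass: "(\<integral>\<^sup>+y\<in>qball \<rho> x r. ennreal (F y) \<partial>M) \<le> ennreal (A * r powr (\<gamma> - \<alpha> - \<beta>))" if r: "r > 0" for x r
    proof -
      have expo: "\<gamma> - (\<gamma> - \<gamma> * lam) / s = \<gamma> - \<alpha> - \<beta>" by (simp add: \<beta>_def w_def algebra_simps)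
      have "(\<integral>\<^sup>+y\<in>qball \<rho> x r. ennreal \<bar>F y\<bar> \<partial>M)
        \<le> ennreal ((c + b1) * N' * r powr (\<gamma> - (\<gamma> - \<gamma> * lam) / s))"
        using power_mass[OF r, of x] c b1 F_nonneg
        by (intro mass_le_of_power_mass F s1 N' r ball_le) auto
      then show ?thesis unfolding expo using F_nonneg by (simp add: A_def A0_def)
    qed
    have \<sigma>_mass: "(\<integral>\<^sup>+y. ennreal (F y) * indicator {y. \<sigma> x y < r} y \<partial>M) \<le> ennreal (A * r powr (\<gamma> - \<alpha> - \<beta>))"
      if r: "r > 0" for x r
    proof -
      have "(\<integral>\<^sup>+y. ennreal (F y) * indicator {y. \<sigma> x y < r} y \<partial>M) \<le> (\<integral>\<^sup>+y\<in>qball \<rho> x r. ennreal (F y) \<partial>M)"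
        using \<sigma>(1) by (intro nn_integral_mono) (auto simp: indicator_def qball_def intro: le_less_trans)
      then show ?thesis using mass[OF r, of x] by (rule order_trans)
    qed
    define g where "g x = (\<integral>\<^sup>+y. ennreal (F y) * ennreal (\<sigma> x y powr - m) \<partial>M)" for x
    have norm_le: "(\<integral>\<^sup>+y. ennreal \<bar>potential_integrand \<rho> \<gamma> \<alpha> f x y\<bar> \<partial>M) \<le> g x" for x
      unfolding g_def
    proof (intro nn_integral_mono)
      fix y
      have "\<bar>potential_integrand \<rho> \<gamma> \<alpha> f x y\<bar> = \<bar>f y\<bar> * (1 / \<rho> x y powr m)"
        by (simp add: potential_integrand_def m_def abs_divide)
      also have "\<dots> \<le> \<bar>f y\<bar> * (L powr m * \<sigma> x y powr - m)" by (intro mult_left_mono kernel) auto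
      also have "\<dots> = F y * \<sigma> x y powr - m" by (simp add: F_def)
      finally show "ennreal \<bar>potential_integrand \<rho> \<gamma> \<alpha> f x y\<bar> \<le> ennreal (F y) * ennreal (\<sigma> x y powr - m)"
        using F_nonneg by (simp add: ennreal_leI flip: ennreal_mult)
    qed
    have integrand_meas [measurable]: "potential_integrand \<rho> \<gamma> \<alpha> f x \<in> borel_measurable M" for x
      unfolding potential_integrand_def by measurable
    have "AE x in M. g x < \<infinity>"
      unfolding g_def m_def
    proof (rule AE_kernel_potential_finite[OF _ _ \<beta> less_imp_le[OF A] \<sigma>_mass])
      have "(\<integral>\<^sup>+y. ennreal (F y) \<partial>M) = (\<integral>\<^sup>+y\<in>qball \<rho> undefined (qdiam \<rho> + 1). ennreal (F y) \<partial>M)"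
        by (simp add: qball_UNIV)
      also have "\<dots> \<le> ennreal (A * (qdiam \<rho> + 1) powr (\<gamma> - \<alpha> - \<beta>))"
        using qdiam_pos by (intro mass) simp
      also have "\<dots> < \<infinity>" by simp
      finally show "(\<integral>\<^sup>+y. ennreal (F y) \<partial>M) < \<infinity>" .
    qed auto
    then have int: "AE x in M. integrable M (potential_integrand \<rho> \<gamma> \<alpha> f x)"
    proof (rule AE_mp, intro AE_I2 impI)
      fix x assume "g x < \<infinity>"
      then show "integrable M (potential_integrand \<rho> \<gamma> \<alpha> f x)"
        using norm_le[of x] by (intro integrableI_bounded) (auto intro: le_less_trans)
    qed
    define u where "u x = \<bar>potential M \<rho> \<gamma> \<alpha> f x\<bar>" for x
    \<comment> \<open>Where the integrand is not integrable the potential is 0 by convention, so the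
      bound holds at every point.\<close>
    have u_le: "ennreal (u x) \<le> g x" for x
    proof (cases "integrable M (potential_integrand \<rho> \<gamma> \<alpha> f x)")
      case True
      have "ennreal (u x) \<le> (\<integral>\<^sup>+y. ennreal \<bar>potential_integrand \<rho> \<gamma> \<alpha> f x y\<bar> \<partial>M)"
        using integral_norm_bound_ennreal[OF True] by (simp add: potential_def u_def)
      also have "\<dots> \<le> g x" by (rule norm_le)
      finally show ?thesis .
    qed (simp add: u_def potential_def not_integrable_integral_eq)
    \<comment> \<open>The constant of \<open>strong_type\<close>. Since \<beta> is at least
      \<open>w / q\<close>, it is at most \<open>N'\<close> times a number free of \<open>s\<close>
      and \<open>t\<close>.\<close>
    define P where "P = 4 * A * ((\<gamma> - \<alpha>) / \<beta>)"
    have P: "0 < P" "P \<le> N' * P1"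
    proof -
      show "0 < P" using A m \<beta> by (simp add: P_def m_def)
      have "w / q \<le> w / t" using w t_less t_pos by (intro divide_left_mono) auto
      then have "m / \<beta> \<le> m / (w / q)" unfolding \<beta>_eq using m w q_pos t_pos t_less by (intro divide_left_mono) auto
      then have "4 * A0 * (m / \<beta>) \<le> 4 * A0 * (m / (w / q))" using A0 by (intro mult_left_mono) auto
      also have "\<dots> \<le> P1" by (simp add: P1_def)
      finally have "N' * (4 * A0 * (m / \<beta>)) \<le> N' * P1" using N' by (intro mult_left_mono) auto
      then show "P \<le> N' * P1" by (simp add: P_def m_def A_def ac_simps)
    qed
    have P1: "P1 \<ge> 1" by (simp add: P1_def)
    have P_powr: "P powr e \<le> N' powr e * P1 powr q" if "0 \<le> e" "e \<le> q" for e
    proof -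
      have "P powr e \<le> (N' * P1) powr e" using P that by (intro powr_mono2) auto
      also have "\<dots> = N' powr e * P1 powr e" using N' P1 by (simp add: powr_mult)
      also have "\<dots> \<le> N' powr e * P1 powr q" using P1 that by (intro mult_left_mono powr_mono) auto
      finally show ?thesis .
    qed
    have "(\<integral>\<^sup>+y\<in>qball \<rho> x r. ennreal (\<bar>potential M \<rho> \<gamma> \<alpha> f y\<bar> powr t) \<partial>M) \<le> ennreal (C * N powr t * r powr (\<gamma> * lam))"
      if r: "0 < r" for x r
    proof -
      have Kr: "2 * K * r > 0" using K(1) r by simp
      note [measurable] = qball_sets[OF r, of x] qball_sets[OF Kr, of x]
      \<comment> \<open>The ball enlarged by \<open>2 * K\<close> plays the role of
        \<open>B'\<close> in \<open>strong_type\<close>.\<close>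
      have sub: "z \<in> qball \<rho> x (2 * K * r)" if "y \<in> qball \<rho> x r" "\<sigma> y z < r" for y z
      proof -
        have "\<rho> x z \<le> K * (\<rho> x y + \<rho> y z)" by (rule K)
        also have "\<dots> < K * (r + r)"
          using that \<sigma>(1)[of y z] K(1) by (intro mult_strict_left_mono add_strict_mono) (auto simp: qball_def)
        finally show ?thesis by (simp add: qball_def)
      qed
      have "(\<integral>\<^sup>+y\<in>qball \<rho> x r. ennreal (u y powr t) \<partial>M)
        \<le> ennreal ((P * r powr - \<beta>) powr t) * emeasure M (qball \<rho> x r)
        + ennreal (s / (2 * (s - 1)) * Q powr s * P powr (t - s)) * (\<integral>\<^sup>+y\<in>qball \<rho> x (2 * K * r). ennreal (F y powr s) \<partial>M)"
        unfolding P_def Q_def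
        using sub u_le unfolding g_def m_def by (intro strong_type s1 st \<beta> ratio A r \<sigma>_mass) (auto simp: u_def F_nonneg)
      also have "\<dots> \<le> ennreal ((P * r powr - \<beta>) powr t) * ennreal (b1 * r powr \<gamma>)
        + ennreal (s / (2 * (s - 1)) * Q powr s * P powr (t - s)) * ennreal (c * N' powr s * (2 * K * r) powr (\<gamma> * lam))"
        by (intro add_mono mult_left_mono ball_le power_mass r Kr) auto
      also have "\<dots> = ennreal ((P * r powr - \<beta>) powr t * (b1 * r powr \<gamma>)
        + s / (2 * (s - 1)) * Q powr s * P powr (t - s) * (c * N' powr s * (2 * K * r) powr (\<gamma> * lam)))"
        using s1 c b1 by (simp flip: ennreal_mult ennreal_plus)
      also have "\<dots> \<le> ennreal (C0 * N' powr t * r powr (\<gamma> * lam))"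
      proof (rule ennreal_leI)
        \<comment> \<open>Since \<open>\<beta> * t = (1 - lam) * \<gamma>\<close>, the first term
          already scales in \<open>r\<close> like the Morrey bound.\<close>
        have "(r powr - \<beta>) powr t * r powr \<gamma> = r powr (\<gamma> * lam)"
        proof -
          have "- \<beta> * t + \<gamma> = \<gamma> * lam" using t_pos by (simp add: \<beta>_eq w_def field_simps)
          then show ?thesis by (simp add: powr_powr flip: powr_add)
        qed
        then have "(P * r powr - \<beta>) powr t * (b1 * r powr \<gamma>) = b1 * P powr t * r powr (\<gamma> * lam)"
          using P by (simp add: powr_mult mult.assoc)
        also have "\<dots> \<le> b1 * (N' powr t * P1 powr q) * r powr (\<gamma> * lam)"
          using b1 t_pos t_less by (intro mult_right_mono mult_left_mono P_powr) auto
        finally have 1: "(P * r powr - \<beta>) powr t * (b1 * r powr \<gamma>) \<le> b1 * (N' powr t * P1 powr q) * r powr (\<gamma> * lam)" .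
        have "s / (2 * (s - 1)) \<le> s\<^sub>0 / (2 * (s\<^sub>0 - 1))"
          using s(1) s0 s1 by (simp add: field_simps)
        moreover have "Q powr s \<le> Q1 powr p"
        proof -
          have "Q powr s \<le> Q1 powr s" using Q s1 by (intro powr_mono2) auto
          also have "\<dots> \<le> Q1 powr p" using s by (intro powr_mono) (auto simp: Q1_def)
          finally show ?thesis .
        qed
        ultimately have "s / (2 * (s - 1)) * Q powr s \<le> s\<^sub>0 / (2 * (s\<^sub>0 - 1)) * Q1 powr p"
          using s0 by (intro mult_mono) auto
        moreover have "P powr (t - s) \<le> N' powr (t - s) * P1 powr q"
          using st t_less s1 by (intro P_powr) auto
        ultimately have "s / (2 * (s - 1)) * Q powr s * P powr (t - s)
          \<le> s\<^sub>0 / (2 * (s\<^sub>0 - 1)) * Q1 powr p * (N' powr (t - s) * P1 powr q)"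
          by (rule mult_mono) (use s0 in auto)
        then have "s / (2 * (s - 1)) * Q powr s * P powr (t - s) * (c * N' powr s * (2 * K * r) powr (\<gamma> * lam))
          \<le> s\<^sub>0 / (2 * (s\<^sub>0 - 1)) * Q1 powr p * (N' powr (t - s) * P1 powr q) * (c * N' powr s * (2 * K * r) powr (\<gamma> * lam))"
          using c by (intro mult_right_mono) auto
        also have "\<dots> = s\<^sub>0 / (2 * (s\<^sub>0 - 1)) * Q1 powr p * P1 powr q * (c * (2 * K) powr (\<gamma> * lam)) * N' powr t * r powr (\<gamma> * lam)"
        proof -
          have "N' powr (t - s) * N' powr s = N' powr t" by (simp flip: powr_add)
          moreover have "(2 * K * r) powr (\<gamma> * lam) = (2 * K) powr (\<gamma> * lam) * r powr (\<gamma> * lam)"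
            using K(1) r by (simp add: powr_mult)
          moreover have "a * (x * y) * (c * z * (d * v)) = a * y * (c * d) * (x * z) * v" for a x y z d v
            by (simp only: ac_simps)
          ultimately show ?thesis by metis
        qed
        finally have 2: "s / (2 * (s - 1)) * Q powr s * P powr (t - s) * (c * N' powr s * (2 * K * r) powr (\<gamma> * lam))
          \<le> s\<^sub>0 / (2 * (s\<^sub>0 - 1)) * Q1 powr p * P1 powr q * (c * (2 * K) powr (\<gamma> * lam)) * N' powr t * r powr (\<gamma> * lam)" .
        have "b1 * (N' powr t * P1 powr q) * r powr (\<gamma> * lam) = P1 powr q * b1 * N' powr t * r powr (\<gamma> * lam)"
          by (simp only: ac_simps)
        then show "(P * r powr - \<beta>) powr t * (b1 * r powr \<gamma>)
          + s / (2 * (s - 1)) * Q powr s * P powr (t - s) * (c * N' powr s * (2 * K * r) powr (\<gamma> * lam))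
          \<le> C0 * N' powr t * r powr (\<gamma> * lam)"
          using add_mono[OF 1 2] by (simp only: C0_def distrib_right)
      qed
      finally have main: "(\<integral>\<^sup>+y\<in>qball \<rho> x r. ennreal (u y powr t) \<partial>M) \<le> ennreal (C0 * N' powr t * r powr (\<gamma> * lam))" .
      have C0: "C0 \<ge> 0" using b1 c s0 by (simp add: C0_def)
      have "N' powr t = L powr (m * t) * N powr t"
        using Lm N by (simp add: N'_def powr_mult powr_powr)
      also have "\<dots> \<le> L powr (m * q) * N powr t"
        using L m t_less by (intro mult_right_mono powr_mono) auto
      finally have "C0 * N' powr t \<le> C0 * (L powr (m * q) * N powr t)" using C0 by (intro mult_left_mono)
      also have "\<dots> = (L powr (m * q) * C0) * N powr t" by (simp only: ac_simps)
      also have "\<dots> \<le> C * N powr t" by (intro mult_right_mono) (auto simp: C_def)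
      finally have "ennreal (C0 * N' powr t * r powr (\<gamma> * lam)) \<le> ennreal (C * N powr t * r powr (\<gamma> * lam))"
        by (intro ennreal_leI mult_right_mono) auto
      with main show ?thesis unfolding u_def by (rule order_trans)
    qed
    then show ?thesis using int unfolding morrey_bound_def by blast
  qed
  then show ?thesis by (rule that[OF C1])
qed

end

section \<open>Grand Morrey spaces\<close>

text \<open>Preimages under \<open>f\<close> and \<open>g\<close> differ by a negligible set, which
  is measurable by completeness.\<close>

lemma (in complete_measure) borel_measurable_AE_eq:
  fixes f g :: "'a \<Rightarrow> 'b::topological_space"
  assumes f: "f \<in> borel_measurable M" and ae: "AE x in M. f x = g x"
  shows "g \<in> borel_measurable M"
proof (rule measurableI)
  fix A :: "'b set" assume A: "A \<in> sets borel"
  have "AE x in M. x \<in> f -` A \<inter> space M \<longleftrightarrow> x \<in> g -` A \<inter> space M"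
    using ae by eventually_elim simp
  from in_sets_AE[OF this measurable_sets[OF f A]] show "g -` A \<inter> space M \<in> sets M" by simp
qed simp

text \<open>The potential need not be measurable. The integrals of \<open>u\<close> are then lower integrals, which are
  not subadditive, so the pointwise inequality is integrated along the simple functions below.\<close>

lemma nn_integral_powr_interpolate:
  fixes u :: "'a \<Rightarrow> real"
  assumes B [measurable]: "B \<in> sets M" and t: "0 < t" "t \<le> s" and a: "0 < a"
  shows "(\<integral>\<^sup>+x\<in>B. ennreal (\<bar>u x\<bar> powr t) \<partial>M)
    \<le> ennreal (a powr (t - s)) * (\<integral>\<^sup>+x\<in>B. ennreal (\<bar>u x\<bar> powr s) \<partial>M) + ennreal (a powr t) * emeasure M B"
    (is "_ \<le> ?R")
proof -
  have "integral\<^sup>S M g \<le> ?R" if g: "simple_function M g" and le: "g \<le> (\<lambda>x. ennreal (\<bar>u x\<bar> powr t) * indicator B x)" for g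
  proof -
    have [measurable]: "g \<in> borel_measurable M" using g by (rule borel_measurable_simple_function)
    \<comment> \<open>On \<open>B\<close>, \<open>w x powr (1 / t)\<close> is a measurable minorant
      of the absolute value of \<open>u\<close>. The interpolation is applied to it, where integrals
      are additive, and the result is compared with \<open>u\<close> by monotonicity only.\<close>
    define w where "w x = enn2real (g x)" for x
    have g_le: "g x \<le> ennreal (\<bar>u x\<bar> powr t) * indicator B x" for x using le by (simp add: le_fun_def)
    have gw: "g x = ennreal (w x)" for x
    proof -
      have "ennreal (\<bar>u x\<bar> powr t) * indicator B x < \<infinity>" by (simp add: ennreal_mult_less_top indicator_def)
      then have "g x < \<infinity>" using g_le[of x] by (rule le_less_trans[rotated])
      then show ?thesis by (simp add: w_def)
    qed
    have w: "0 \<le> w x" for x by (simp add: w_def)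
    have w_le: "w x \<le> \<bar>u x\<bar> powr t * indicator B x" for x
      using g_le[of x] w[of x] by (cases "x \<in> B") (auto simp: gw)
    have [measurable]: "w \<in> borel_measurable M" unfolding w_def by measurable
    have "integral\<^sup>S M g = (\<integral>\<^sup>+x. g x \<partial>M)" by (rule nn_integral_eq_simple_integral[OF g, symmetric])
    also have "\<dots> \<le> (\<integral>\<^sup>+x. ennreal (a powr (t - s)) * ennreal (w x powr (s / t)) + ennreal (a powr t) * indicator B x \<partial>M)"
    proof (intro nn_integral_mono)
      fix x
      show "g x \<le> ennreal (a powr (t - s)) * ennreal (w x powr (s / t)) + ennreal (a powr t) * indicator B x"
      proof (cases "x \<in> B")
        case True
        have "w x = (w x powr (1 / t)) powr t" using w[of x] t by (simp add: powr_powr)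
        also have "\<dots> \<le> a powr (t - s) * (w x powr (1 / t)) powr s + a powr t"
          using a t by (intro powr_le_interpolate) auto
        also have "(w x powr (1 / t)) powr s = w x powr (s / t)" by (simp add: powr_powr)
        finally show ?thesis using True by (simp add: gw ennreal_leI flip: ennreal_mult ennreal_plus)
      next
        case False
        then show ?thesis using w_le[of x] w[of x] by (simp add: gw)
      qed
    qed
    also have "\<dots> = ennreal (a powr (t - s)) * (\<integral>\<^sup>+x. ennreal (w x powr (s / t)) \<partial>M) + ennreal (a powr t) * emeasure M B"
      by (simp add: nn_integral_add nn_integral_cmult nn_integral_cmult_indicator)
    also have "\<dots> \<le> ?R"
    proof (intro add_right_mono mult_left_mono nn_integral_mono)
      fix x
      show "ennreal (w x powr (s / t)) \<le> ennreal (\<bar>u x\<bar> powr s) * indicator B x"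
      proof (cases "x \<in> B")
        case True
        then have "w x powr (s / t) \<le> (\<bar>u x\<bar> powr t) powr (s / t)"
          using w_le[of x] w[of x] t by (intro powr_mono2) auto
        then show ?thesis using True t by (simp add: powr_powr ennreal_leI)
      next
        case False
        then show ?thesis using w_le[of x] w[of x] by simp
      qed
    qed auto
    finally show ?thesis .
  qed
  then show ?thesis
    unfolding nn_integral_def[of M "\<lambda>x. ennreal (\<bar>u x\<bar> powr t) * indicator B x"] by (intro SUP_least) auto
qed

section \<open>The grand norm without roots and suprema\<close>

lemma ennreal_powr_le_iff:
  assumes "t > 0" "G \<ge> 0"
  shows "ennreal_powr a (1 / t) \<le> ennreal G \<longleftrightarrow> a \<le> ennreal (G powr t)"
proof (cases a rule: ennreal_cases)
  case (real v)
  have "v powr (1 / t) \<le> G \<longleftrightarrow> v \<le> G powr t"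
  proof
    assume "v powr (1 / t) \<le> G"
    then have "(v powr (1 / t)) powr t \<le> G powr t" using assms by (intro powr_mono2) auto
    then show "v \<le> G powr t" using assms real by (simp add: powr_powr)
  next
    assume "v \<le> G powr t"
    then have "v powr (1 / t) \<le> (G powr t) powr (1 / t)" using assms real by (intro powr_mono2) auto
    then show "v powr (1 / t) \<le> G" using assms by (simp add: powr_powr)
  qed
  then show ?thesis using real assms by (simp add: ennreal_powr_def)
qed (simp add: ennreal_powr_def top_unique)

lemma ennreal_mult_le_iff_le_divide:
  assumes "k > 0" "c \<ge> 0"
  shows "ennreal k * a \<le> ennreal c \<longleftrightarrow> a \<le> ennreal (c / k)"
proof -
  have "ennreal c = ennreal k * ennreal (c / k)" using assms by (simp flip: ennreal_mult)
  then show ?thesis using assms by (simp add: ennreal_mult_le_mult_iff)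
qed

text \<open>This turns the grand norm into a family of Morrey bounds, one for each exponent
  \<open>s - \<epsilon>\<close>, whose constants may grow like
  \<open>\<epsilon> powr - \<theta>\<close>.\<close>

lemma grand_morrey_norm_le_iff:
  assumes "G \<ge> 0"
  shows "grand_morrey_norm M \<rho> \<gamma> s \<theta> lam f \<le> ennreal G \<longleftrightarrow>
    (\<forall>\<epsilon>\<in>{0<..<s - 1}. \<forall>x\<in>space M. \<forall>r\<in>{0<..<qdiam \<rho>}.
      (\<integral>\<^sup>+y\<in>qball \<rho> x r. ennreal (\<bar>f y\<bar> powr (s - \<epsilon>)) \<partial>M)
        \<le> ennreal (G powr (s - \<epsilon>) / \<epsilon> powr \<theta> * r powr (\<gamma> * lam)))"
proof -
  have "ennreal_powr (ennreal (\<epsilon> powr \<theta> / r powr (\<gamma> * lam)) * a) (1 / (s - \<epsilon>)) \<le> ennreal G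
    \<longleftrightarrow> a \<le> ennreal (G powr (s - \<epsilon>) / \<epsilon> powr \<theta> * r powr (\<gamma> * lam))"
    if "\<epsilon> \<in> {0<..<s - 1}" "r \<in> {0<..<qdiam \<rho>}" for \<epsilon> r a
    using that assms by (simp add: ennreal_powr_le_iff ennreal_mult_le_iff_le_divide)
  then show ?thesis unfolding grand_morrey_norm_def SUP_le_iff by (intro ball_cong refl) auto
qed

text \<open>The integrand agrees almost everywhere with a product measurable \<open>h\<close>. The
  integral of \<open>h\<close> over \<open>y\<close> is measurable in \<open>x\<close> and equals
  the potential for almost every \<open>x\<close>; completeness of \<open>M\<close> does the
  rest.\<close>

lemma (in homogeneous_space) potential_measurable:
  assumes \<rho>: "(\<lambda>(x, y). \<rho> x y) \<in> borel_measurable (completion (M \<Otimes>\<^sub>M M))"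
    and f [measurable]: "f \<in> borel_measurable M"
  shows "potential M \<rho> \<gamma> \<alpha> f \<in> borel_measurable M"
proof -
  interpret M: finite_measure M by (rule finite_measure_M)
  interpret pair_sigma_finite M M by unfold_locales
  let ?h = "\<lambda>z. potential_integrand \<rho> \<gamma> \<alpha> f (fst z) (snd z)"
  have [measurable]: "(\<lambda>z. \<rho> (fst z) (snd z)) \<in> borel_measurable (completion (M \<Otimes>\<^sub>M M))"
    using \<rho> by (simp add: split_beta')
  have [measurable]: "(\<lambda>z. f (snd z)) \<in> borel_measurable (completion (M \<Otimes>\<^sub>M M))"
    by (rule measurable_completion) measurable
  have "?h \<in> borel_measurable (completion (M \<Otimes>\<^sub>M M))" unfolding potential_integrand_def by measurable
  from completion_ex_borel_measurable_real[OF this]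
  obtain h where h [measurable]: "h \<in> borel_measurable (M \<Otimes>\<^sub>M M)" and ae: "AE z in M \<Otimes>\<^sub>M M. ?h z = h z" by blast
  have int [measurable]: "potential_integrand \<rho> \<gamma> \<alpha> f x \<in> borel_measurable M" for x
    unfolding potential_integrand_def by measurable
  have "AE x in M. AE y in M. potential_integrand \<rho> \<gamma> \<alpha> f x y = h (x, y)"
    using AE_pair[OF ae] by simp
  then have "AE x in M. (\<integral>y. h (x, y) \<partial>M) = potential M \<rho> \<gamma> \<alpha> f x"
  proof (rule AE_mp, intro AE_I2 impI)
    fix x assume x: "x \<in> space M" "AE y in M. potential_integrand \<rho> \<gamma> \<alpha> f x y = h (x, y)"
    have "(\<lambda>y. h (x, y)) \<in> borel_measurable M" using x(1) by measurable
    then show "(\<integral>y. h (x, y) \<partial>M) = potential M \<rho> \<gamma> \<alpha> f x"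
      unfolding potential_def using x(2) by (intro integral_cong_AE) auto
  qed
  moreover have "(\<lambda>x. \<integral>y. h (x, y) \<partial>M) \<in> borel_measurable M" by measurable
  ultimately show ?thesis by (rule borel_measurable_AE_eq[rotated])
qed

theorem theorem4p1:
  fixes M :: "'a::topological_space measure"
    and \<rho> :: "'a \<Rightarrow> 'a \<Rightarrow> real"
    and b \<gamma> p q lam \<alpha> \<theta>\<^sub>1 \<theta>\<^sub>2 :: real
  assumes "homogeneous_space M \<rho>"
    and "b > 0" and "\<gamma> > 0"
    and "\<And>x r. 0 < r \<Longrightarrow> r < qdiam \<rho> \<Longrightarrow> emeasure M (qball \<rho> x r) \<le> ennreal (b * r powr \<gamma>)"
    and "1 < p"
    and "0 \<le> lam" and "lam < 1 / \<gamma>"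
    and "0 < \<alpha>" and "\<alpha> < (1 - lam) * \<gamma> / p"
    and "1 / p - 1 / q = \<alpha> / ((1 - lam) * \<gamma>)"
    and "\<theta>\<^sub>1 > 0"
    and "\<theta>\<^sub>2 = (1 + \<alpha> * q / ((1 - lam) * \<gamma>)) * \<theta>\<^sub>1"
  shows "\<exists>C>0. \<forall>f\<in>grand_morrey M \<rho> \<gamma> p \<theta>\<^sub>1 lam.
     (AE x in M. integrable M (potential_integrand \<rho> \<gamma> \<alpha> f x)) \<and>
     grand_morrey_norm M \<rho> \<gamma> q \<theta>\<^sub>2 lam (potential M \<rho> \<gamma> \<alpha> f)
       \<le> ennreal C * grand_morrey_norm M \<rho> \<gamma> p \<theta>\<^sub>1 lam f \<and>
     ((\<lambda>(x, y). \<rho> x y) \<in> borel_measurable (completion (M \<Otimes>\<^sub>M M)) \<longrightarrow>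
        potential M \<rho> \<gamma> \<alpha> f \<in> grand_morrey M \<rho> \<gamma> q \<theta>\<^sub>2 lam)"
proof -
  interpret homogeneous_space M \<rho> by fact

  \<comment> \<open>Exponents and constants\<close>
  note b = assms(2) and \<gamma> = assms(3) and growth = assms(4) and p = assms(5) and lam = assms(6)
    and \<alpha> = assms(8,9) and q = assms(10) and \<theta>1 = assms(11) and \<theta>2 = assms(12)
  \<comment> \<open>This comes from the range of \<alpha>: a positive \<alpha> below
    \<open>(1 - lam) * \<gamma> / p\<close> forces it, whereas \<open>1 / \<gamma>\<close> may
    exceed 1.\<close>
  have lam1: "lam < 1"
  proof -
    have "0 < (1 - lam) * \<gamma> / p" using \<alpha> by linarith
    then show ?thesis using \<gamma> p by (simp add: zero_less_mult_iff zero_less_divide_iff)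
  qed
  define A where "A = \<alpha> / ((1 - lam) * \<gamma>)"
  have w: "(1 - lam) * \<gamma> > 0" using lam1 \<gamma> by simp
  have A: "A > 0" using \<alpha> w by (simp add: A_def)
  have "A < 1 / p" using \<alpha> w p by (simp add: A_def field_simps)
  then have "1 / q > 0" using q unfolding A_def by linarith
  then have q_pos: "q > 0" by simp
  have q_eq: "1 / p - 1 / q = A" using q by (simp add: A_def)
  then have "1 / q < 1 / p" using A by simp
  then have pq: "p < q" using p q_pos by (simp add: field_simps)
  have \<theta>2_eq: "\<theta>\<^sub>2 = (1 + A * q) * \<theta>\<^sub>1" using \<theta>2 by (simp add: A_def)
  have \<theta>2_pos: "\<theta>\<^sub>2 > 0" using \<theta>2_eq \<theta>1 A q_pos by (simp add: add_pos_pos)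

  \<comment> \<open>Any fixed exponent strictly between 1 and \<open>p\<close> would do; its partner
    \<open>t\<^sub>0\<close> separates the two ranges of target exponents.\<close>
  define s\<^sub>0 where "s\<^sub>0 = (1 + p) / 2"
  define t\<^sub>0 where "t\<^sub>0 = 1 / (1 / s\<^sub>0 - A)"
  define e\<^sub>0 where "e\<^sub>0 = p - s\<^sub>0"
  have s0: "1 < s\<^sub>0" "s\<^sub>0 < p" using p by (auto simp: s\<^sub>0_def)
  have e0: "e\<^sub>0 \<in> {0<..<p - 1}" using s0 by (simp add: e\<^sub>0_def)
  have "1 / p < 1 / s\<^sub>0" using s0 by (intro divide_strict_left_mono) auto
  then have "1 / q < 1 / s\<^sub>0 - A" using q_eq by simp
  then have t0: "1 / t\<^sub>0 = 1 / s\<^sub>0 - A" "1 / q < 1 / t\<^sub>0" by (auto simp: t\<^sub>0_def)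
  have t0_pos: "t\<^sub>0 > 0" using t0(2) q_pos by (metis divide_pos_pos less_trans zero_less_divide_1_iff zero_less_one)
  have t0_q: "t\<^sub>0 < q" using t0(2) t0_pos q_pos by (simp add: field_simps)

  obtain C where C: "C \<ge> 1" and estimate:
    "\<And>s t f N. s\<^sub>0 \<le> s \<Longrightarrow> s < p \<Longrightarrow> 1 / s - 1 / t = \<alpha> / ((1 - lam) * \<gamma>) \<Longrightarrow> f \<in> borel_measurable M \<Longrightarrow> N > 0 \<Longrightarrow>
      morrey_bound M \<rho> s (\<gamma> * lam) (N powr s) f \<Longrightarrow>
      (AE x in M. integrable M (potential_integrand \<rho> \<gamma> \<alpha> f x)) \<and>
      morrey_bound M \<rho> t (\<gamma> * lam) (C * N powr t) (potential M \<rho> \<gamma> \<alpha> f)"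
    by (rule potential_morrey_estimate[OF b \<gamma> _ lam lam1 \<alpha> q s0]) (erule (1) growth, blast)

  \<comment> \<open>\<open>D\<close> converts \<open>r powr \<gamma>\<close> into
    \<open>r powr (\<gamma> * lam)\<close> for radii below the diameter, and \<open>E\<close> is the
    weight at the fixed exponent \<open>s\<^sub>0\<close>. \<open>C2\<close> handles targets from
    \<open>t\<^sub>0\<close> up to \<open>q\<close>, \<open>C3 * E\<close> those below.\<close>
  define D where "D = qdiam \<rho> powr (\<gamma> * (1 - lam))"
  define E where "E = e\<^sub>0 powr - (\<theta>\<^sub>1 / s\<^sub>0)"
  define C2 where "C2 = C * (q\<^sup>2) powr \<theta>\<^sub>2 * p powr \<theta>\<^sub>2"
  define C3 where "C3 = (C + b * D) * q powr \<theta>\<^sub>2"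
  define C' where "C' = max C2 (C3 * E)"
  have q1: "q > 1" using p pq by simp
  have C2: "C2 \<ge> 1"
    unfolding C2_def using C q1 p \<theta>2_pos by (intro mult_ge1_I ge_one_powr_ge_zero) auto
  have C3: "C3 \<ge> 1" unfolding C3_def
    using C b q1 \<theta>2_pos by (intro mult_ge1_I ge_one_powr_ge_zero) (auto simp: D_def add_increasing2)
  have C': "C' \<ge> 1" using C2 by (simp add: C'_def)

  \<comment> \<open>The weight is moved into the Morrey constant, which may therefore blow up as
    \<open>e\<close> tends to 0; the weight in \<eta> has to compensate.\<close>
  have hyp: "morrey_bound M \<rho> (p - e) (\<gamma> * lam) ((G * e powr - (\<theta>\<^sub>1 / (p - e))) powr (p - e)) f"
    if "grand_morrey_norm M \<rho> \<gamma> p \<theta>\<^sub>1 lam f \<le> ennreal G" "G > 0" "e \<in> {0<..<p - 1}" for f G e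
  proof -
    have "(e powr - (\<theta>\<^sub>1 / (p - e))) powr (p - e) = e powr - \<theta>\<^sub>1"
      using that by (simp add: powr_powr)
    then have "(G * e powr - (\<theta>\<^sub>1 / (p - e))) powr (p - e) = G powr (p - e) / e powr \<theta>\<^sub>1"
      using that by (simp only: powr_mult powr_minus_divide) simp
    then show ?thesis using that by (simp add: grand_morrey_norm_le_iff space_M morrey_bound_def)
  qed

  have integrable: "AE x in M. integrable M (potential_integrand \<rho> \<gamma> \<alpha> f x)"
    if "f \<in> borel_measurable M" "grand_morrey_norm M \<rho> \<gamma> p \<theta>\<^sub>1 lam f \<le> ennreal G" "G > 0" for f G
    using estimate[of s\<^sub>0 t\<^sub>0 f "G * e\<^sub>0 powr - (\<theta>\<^sub>1 / s\<^sub>0)"] hyp[OF that(2,3) e0] that s0 e0 t0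
    by (simp add: e\<^sub>0_def A_def)

  \<comment> \<open>Target exponents near \<open>q\<close> and away from \<open>q\<close>\<close>
  have norm_bound: "grand_morrey_norm M \<rho> \<gamma> q \<theta>\<^sub>2 lam (potential M \<rho> \<gamma> \<alpha> f) \<le> ennreal (C' * G)"
    if f: "f \<in> borel_measurable M" and norm: "grand_morrey_norm M \<rho> \<gamma> p \<theta>\<^sub>1 lam f \<le> ennreal G" and G: "G > 0" for f G
  proof -
    have "(\<integral>\<^sup>+y\<in>qball \<rho> x r. ennreal (\<bar>potential M \<rho> \<gamma> \<alpha> f y\<bar> powr (q - \<eta>)) \<partial>M)
      \<le> ennreal ((C' * G) powr (q - \<eta>) / \<eta> powr \<theta>\<^sub>2 * r powr (\<gamma> * lam))"
      if \<eta>: "0 < \<eta>" "\<eta> < q - 1" and r: "0 < r" "r < qdiam \<rho>" for \<eta> x r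
    proof (cases "t\<^sub>0 \<le> q - \<eta>")
      case True
      define t where "t = q - \<eta>"
      have t: "1 < t" "t < q" "t\<^sub>0 \<le> t" using \<eta> True by (auto simp: t_def)
      \<comment> \<open>The source exponent paired with \<open>t\<close>;
        \<open>t\<^sub>0 \<le> t\<close> and \<open>t < q\<close> place it in the range of the
        uniform estimate.\<close>
      define s where "s = 1 / (1 / t + A)"
      have s_inv: "1 / s = 1 / t + A" by (simp add: s_def)
      have s_pos: "s > 0" using t A by (simp add: s_def add_pos_pos)
      have "1 / q < 1 / t" using t by (intro divide_strict_left_mono) auto
      then have "1 / p < 1 / s" using q_eq s_inv by simp
      then have sp: "s < p" using s_pos p by (simp add: field_simps)
      have "1 / t \<le> 1 / t\<^sub>0" using t t0_pos by (intro divide_left_mono) auto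
      then have "1 / s \<le> 1 / s\<^sub>0" using s_inv t0 by simp
      then have s: "s\<^sub>0 \<le> s" using s_pos s0 by (simp add: field_simps)
      define e where "e = p - s"
      have e: "e \<in> {0<..<p - 1}" using s sp s0 by (simp add: e_def)
      \<comment> \<open>Subtracting the two exponent relations gives
        \<open>\<eta> / (t * q) = e / (s * p)\<close>; then use \<open>t \<le> q\<close> and
        \<open>s * p \<ge> 1\<close>.\<close>
      have "\<eta> \<le> q\<^sup>2 * e"
      proof -
        have "1 / t - 1 / q = 1 / s - 1 / p" using s_inv q_eq by simp
        then have "\<eta> / (t * q) = e / (s * p)" using t s_pos p by (simp add: t_def e_def field_simps)
        then have "\<eta> = t * q * (e / (s * p))" using t by (simp add: field_simps)
        also have "\<dots> \<le> q * q * (e / 1)"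
          using t e s s0 p by (intro mult_mono divide_left_mono) (auto intro: mult_ge1_I simp: less_imp_le mult_pos_pos)
        finally show ?thesis by (simp add: power2_eq_square)
      qed
      then have "\<eta> powr \<theta>\<^sub>2 \<le> (q\<^sup>2 * e) powr \<theta>\<^sub>2" using \<eta> \<theta>2_pos by (intro powr_mono2) auto
      also have "\<dots> = (q\<^sup>2) powr \<theta>\<^sub>2 * e powr \<theta>\<^sub>2" using e by (simp add: powr_mult)
      finally have \<eta>_powr: "\<eta> powr \<theta>\<^sub>2 \<le> (q\<^sup>2) powr \<theta>\<^sub>2 * e powr \<theta>\<^sub>2" .
      \<comment> \<open>The choice of \<open>\<theta>\<^sub>2\<close> enters here: as
        \<open>t / s = 1 + A * t\<close>, the power of \<open>e\<close> left after compensation has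
        a nonnegative exponent and stays bounded as \<open>e\<close> tends to 0.\<close>
      have expo: "\<theta>\<^sub>2 - \<theta>\<^sub>1 / s * t = \<theta>\<^sub>1 * A * \<eta>"
      proof -
        have "t / s = 1 + A * t" using s_inv t by (simp add: divide_inverse distrib_left mult.commute)
        then have "\<theta>\<^sub>1 / s * t = \<theta>\<^sub>1 * (1 + A * t)" by (metis times_divide_eq_left times_divide_eq_right)
        then show ?thesis by (simp add: \<theta>2_eq t_def algebra_simps)
      qed
      \<comment> \<open>The base \<open>e\<close> is below \<open>p\<close>, and the exponent is at
        most \<open>\<theta>\<^sub>2\<close>; as \<open>p > 1\<close>, both may be enlarged.\<close>
      have "e powr (\<theta>\<^sub>1 * A * \<eta>) \<le> p powr \<theta>\<^sub>2"
      proof -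
        have "e powr (\<theta>\<^sub>1 * A * \<eta>) \<le> p powr (\<theta>\<^sub>1 * A * \<eta>)" using e s_pos \<theta>1 A \<eta> by (intro powr_mono2) (auto simp: e_def)
        moreover have "\<theta>\<^sub>1 / s * t \<ge> 0" using \<theta>1 s_pos t by simp
        then have "p powr (\<theta>\<^sub>1 * A * \<eta>) \<le> p powr \<theta>\<^sub>2" using p expo by (intro powr_mono) linarith+
        ultimately show ?thesis by linarith
      qed
      moreover have "e powr - (\<theta>\<^sub>1 / s * t) * e powr \<theta>\<^sub>2 = e powr (\<theta>\<^sub>1 * A * \<eta>)"
        by (simp flip: powr_add expo)
      ultimately have e_powr: "e powr - (\<theta>\<^sub>1 / s * t) * e powr \<theta>\<^sub>2 \<le> p powr \<theta>\<^sub>2" by simp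
      define N where "N = G * e powr - (\<theta>\<^sub>1 / s)"
      have N: "N > 0" using G e by (simp add: N_def)
      have "(\<integral>\<^sup>+y\<in>qball \<rho> x r. ennreal (\<bar>potential M \<rho> \<gamma> \<alpha> f y\<bar> powr t) \<partial>M) \<le> ennreal (C * N powr t * r powr (\<gamma> * lam))"
        using estimate[of s t f N] hyp[OF norm G e] s sp s_inv f N r by (simp add: e_def N_def A_def morrey_bound_def)
      also have "\<dots> \<le> ennreal ((C' * G) powr t / \<eta> powr \<theta>\<^sub>2 * r powr (\<gamma> * lam))"
      proof (intro ennreal_leI mult_right_mono)
        have "C * N powr t * \<eta> powr \<theta>\<^sub>2 \<le> C * N powr t * ((q\<^sup>2) powr \<theta>\<^sub>2 * e powr \<theta>\<^sub>2)"
          using C \<eta>_powr by (intro mult_left_mono) auto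
        also have N_powr: "N powr t = G powr t * e powr - (\<theta>\<^sub>1 / s * t)" using G e by (simp add: N_def powr_mult powr_powr)
        also have "C * (G powr t * e powr - (\<theta>\<^sub>1 / s * t)) * ((q\<^sup>2) powr \<theta>\<^sub>2 * e powr \<theta>\<^sub>2)
          = C * (q\<^sup>2) powr \<theta>\<^sub>2 * (e powr - (\<theta>\<^sub>1 / s * t) * e powr \<theta>\<^sub>2) * G powr t" by (simp only: ac_simps)
        also have "\<dots> \<le> C * (q\<^sup>2) powr \<theta>\<^sub>2 * p powr \<theta>\<^sub>2 * G powr t"
          using C e_powr by (intro mult_right_mono mult_left_mono) auto
        also have "\<dots> = C2 * G powr t" by (simp add: C2_def)
        \<comment> \<open>The norm bound carries \<open>C'\<close> to the power
          \<open>t > 1\<close>, which only helps since \<open>C' \<ge> 1\<close>.\<close>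
        also have "\<dots> \<le> C' powr t * G powr t"
        proof (intro mult_right_mono)
          have "C2 \<le> C' powr 1" using C' by (simp add: C'_def)
          also have "\<dots> \<le> C' powr t" using C' t by (intro powr_mono) auto
          finally show "C2 \<le> C' powr t" .
        qed simp
        also have "\<dots> = (C' * G) powr t" using C' G by (simp add: powr_mult)
        finally show "C * N powr t \<le> (C' * G) powr t / \<eta> powr \<theta>\<^sub>2" using \<eta> by (simp add: pos_le_divide_eq N_powr)
      qed simp
      finally show ?thesis by (simp add: t_def)
    next
      case False
      define t where "t = q - \<eta>"
      have t: "1 < t" "t \<le> t\<^sub>0" using \<eta> False by (auto simp: t_def)
      \<comment> \<open>\<open>N\<close> is the Morrey constant of \<open>f\<close> at the fixed
        exponent \<open>s\<^sub>0\<close>; as interpolation threshold it makes both terms multiples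
        of \<open>N powr t\<close>.\<close>
      define N where "N = G * E"
      have E: "E > 0" using e0 by (simp add: E_def)
      have N: "N > 0" using G E by (simp add: N_def)
      have "(\<integral>\<^sup>+y\<in>qball \<rho> x r. ennreal (\<bar>potential M \<rho> \<gamma> \<alpha> f y\<bar> powr t) \<partial>M)
        \<le> ennreal (N powr (t - t\<^sub>0)) * (\<integral>\<^sup>+y\<in>qball \<rho> x r. ennreal (\<bar>potential M \<rho> \<gamma> \<alpha> f y\<bar> powr t\<^sub>0) \<partial>M)
          + ennreal (N powr t) * emeasure M (qball \<rho> x r)"
        using t N r qball_sets by (intro nn_integral_powr_interpolate) auto
      also have "\<dots> \<le> ennreal (N powr (t - t\<^sub>0)) * ennreal (C * N powr t\<^sub>0 * r powr (\<gamma> * lam)) + ennreal (N powr t) * ennreal (b * r powr \<gamma>)"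
      proof (intro add_mono mult_left_mono growth r)
        show "(\<integral>\<^sup>+y\<in>qball \<rho> x r. ennreal (\<bar>potential M \<rho> \<gamma> \<alpha> f y\<bar> powr t\<^sub>0) \<partial>M) \<le> ennreal (C * N powr t\<^sub>0 * r powr (\<gamma> * lam))"
          using estimate[of s\<^sub>0 t\<^sub>0 f N] hyp[OF norm G e0] s0 t0 f N r
          by (simp add: e\<^sub>0_def N_def A_def E_def morrey_bound_def)
      qed auto
      also have "\<dots> = ennreal (N powr (t - t\<^sub>0) * (C * N powr t\<^sub>0 * r powr (\<gamma> * lam)) + N powr t * (b * r powr \<gamma>))"
        using C b by (simp flip: ennreal_mult ennreal_plus)
      also have "\<dots> \<le> ennreal ((C' * G) powr t / \<eta> powr \<theta>\<^sub>2 * r powr (\<gamma> * lam))"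
      proof (rule ennreal_leI)
        have "r powr \<gamma> \<le> D * r powr (\<gamma> * lam)"
        proof -
          have "r powr \<gamma> = r powr (\<gamma> * (1 - lam)) * r powr (\<gamma> * lam)" by (simp flip: powr_add add: algebra_simps)
          also have "\<dots> \<le> D * r powr (\<gamma> * lam)"
            unfolding D_def using r \<gamma> lam1 by (intro mult_right_mono powr_mono2) auto
          finally show ?thesis .
        qed
        then have "N powr t * (b * r powr \<gamma>) \<le> N powr t * (b * (D * r powr (\<gamma> * lam)))"
          using b by (intro mult_left_mono) auto
        moreover have "N powr (t - t\<^sub>0) * (C * N powr t\<^sub>0 * r powr (\<gamma> * lam)) = N powr t * (C * r powr (\<gamma> * lam))"
          by (simp flip: powr_add)
        ultimately have "N powr (t - t\<^sub>0) * (C * N powr t\<^sub>0 * r powr (\<gamma> * lam)) + N powr t * (b * r powr \<gamma>)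
          \<le> N powr t * (C * r powr (\<gamma> * lam)) + N powr t * (b * (D * r powr (\<gamma> * lam)))" by linarith
        also have "\<dots> = (C + b * D) * N powr t * r powr (\<gamma> * lam)" by (simp add: algebra_simps)
        also have "\<dots> \<le> (C' * G) powr t / \<eta> powr \<theta>\<^sub>2 * r powr (\<gamma> * lam)"
        proof (intro mult_right_mono)
          \<comment> \<open>In this range the weight needs no compensation:
            \<open>\<eta> < q\<close> bounds it by a constant.\<close>
          have "(C + b * D) * N powr t * \<eta> powr \<theta>\<^sub>2 \<le> (C + b * D) * N powr t * q powr \<theta>\<^sub>2"
            using \<eta> \<theta>2_pos C b by (intro mult_left_mono powr_mono2) (auto simp: D_def)
          also have "\<dots> = C3 * N powr t" by (simp add: C3_def)
          also have "\<dots> \<le> C3 powr t * N powr t"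
            using powr_mono[of 1 t C3] C3 t by (intro mult_right_mono) auto
          also have "\<dots> = (C3 * E * G) powr t" using C3 E G by (simp add: N_def powr_mult)
          also have "\<dots> \<le> (C' * G) powr t"
            using C3 E G t by (intro powr_mono2 mult_right_mono) (auto simp: C'_def)
          finally show "(C + b * D) * N powr t \<le> (C' * G) powr t / \<eta> powr \<theta>\<^sub>2" using \<eta> by (simp add: pos_le_divide_eq)
        qed simp
        finally show "N powr (t - t\<^sub>0) * (C * N powr t\<^sub>0 * r powr (\<gamma> * lam)) + N powr t * (b * r powr \<gamma>)
          \<le> (C' * G) powr t / \<eta> powr \<theta>\<^sub>2 * r powr (\<gamma> * lam)" .
      qed
      finally show ?thesis by (simp add: t_def)
    qed
    then show ?thesis using C' G by (subst grand_morrey_norm_le_iff) auto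
  qed

  \<comment> \<open>Passage from positive bounds \<open>G\<close> to the norm itself\<close>
  show ?thesis
  proof (intro exI[of _ C'] conjI ballI impI)
    show "C' > 0" using C' by simp
    fix f assume "f \<in> grand_morrey M \<rho> \<gamma> p \<theta>\<^sub>1 lam"
    then have f: "f \<in> borel_measurable M" and fin: "grand_morrey_norm M \<rho> \<gamma> p \<theta>\<^sub>1 lam f < \<infinity>"
      by (auto simp: grand_morrey_def)
    then obtain v where v: "v \<ge> 0" "grand_morrey_norm M \<rho> \<gamma> p \<theta>\<^sub>1 lam f = ennreal v"
      by (cases "grand_morrey_norm M \<rho> \<gamma> p \<theta>\<^sub>1 lam f" rule: ennreal_cases) auto
    show "AE x in M. integrable M (potential_integrand \<rho> \<gamma> \<alpha> f x)"
      using v by (intro integrable[OF f, of "v + 1"]) (auto intro: ennreal_leI)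
    show bound: "grand_morrey_norm M \<rho> \<gamma> q \<theta>\<^sub>2 lam (potential M \<rho> \<gamma> \<alpha> f)
       \<le> ennreal C' * grand_morrey_norm M \<rho> \<gamma> p \<theta>\<^sub>1 lam f"
    proof (rule ennreal_le_epsilon)
      \<comment> \<open>\<open>norm_bound\<close> needs a positive \<open>G\<close>, while the norm
        of \<open>f\<close> may be 0; the slack \<open>\<epsilon> / C'\<close> covers this
        case.\<close>
      fix \<epsilon> :: real assume \<epsilon>: "\<epsilon> > 0"
      have "grand_morrey_norm M \<rho> \<gamma> q \<theta>\<^sub>2 lam (potential M \<rho> \<gamma> \<alpha> f) \<le> ennreal (C' * (v + \<epsilon> / C'))"
        using v \<epsilon> C' by (intro norm_bound[OF f]) (auto intro!: ennreal_leI add_nonneg_pos)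
      also have "\<dots> = ennreal C' * grand_morrey_norm M \<rho> \<gamma> p \<theta>\<^sub>1 lam f + ennreal \<epsilon>"
        using v \<epsilon> C' by (simp add: distrib_left flip: ennreal_mult ennreal_plus)
      finally show "grand_morrey_norm M \<rho> \<gamma> q \<theta>\<^sub>2 lam (potential M \<rho> \<gamma> \<alpha> f)
        \<le> ennreal C' * grand_morrey_norm M \<rho> \<gamma> p \<theta>\<^sub>1 lam f + ennreal \<epsilon>" .
    qed
    assume \<rho>: "(\<lambda>(x, y). \<rho> x y) \<in> borel_measurable (completion (M \<Otimes>\<^sub>M M))"
    have "ennreal C' * grand_morrey_norm M \<rho> \<gamma> p \<theta>\<^sub>1 lam f < \<infinity>"
      using fin by (simp add: ennreal_mult_less_top)
    with bound show "potential M \<rho> \<gamma> \<alpha> f \<in> grand_morrey M \<rho> \<gamma> q \<theta>\<^sub>2 lam"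
      using potential_measurable[OF \<rho> f] by (auto simp: grand_morrey_def intro: le_less_trans)
  qed
qed

end
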